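(* Let $\alpha\ge-\frac12$, $0<\beta<d_\alpha$, $\gamma>0$, $1<p<\infty$, and let $t\in\Big(\frac{d_\alpha}{d_\alpha+\gamma-\beta},\frac{d_\alpha}{d_\alpha-\beta}\Big)$ with $t\ge1$. Let $\phi:\mathbb{R}^+\to\mathbb{R}^+$ be measurable, with $\phi$ almost decreasing and $r\mapsto r^{d_\alpha/p}\phi(r)$ almost increasing, and suppose that for some $\nu<-\beta$ and some constant $C_0>0$, $\phi(r)\le C_0r^\nu$ for every $r>0$. Then the Dunkl-type Bessel–Riesz operator $I_{\beta,\gamma}^\alpha$ is bounded from $L^{p,\phi}(\mathbb{R},d\mu_\alpha)$ to $L^{q,\psi}(\mathbb{R},d\mu_\alpha)$: there is a constant $C>0$ such that for all $f\in L^{p,\phi}(\mathbb{R},d\mu_\alpha)$, $$\|I_{\beta,\gamma}^\alpha f\|_{L^{q,\psi}(\mathbb{R},d\mu_\alpha)}\le C\,\|K_{\beta,\gamma}^\alpha\|_{L^t(\mathbb{R},d\mu_\alpha)}\,\|f\|_{L^{p,\phi}(\mathbb{R},d\mu_\alpha)},$$ where $q=\frac{\nu t'p}{\nu t'+d_\alpha}$ with $\frac1t+\frac1{t'}=1$ (read as $q=p$ when $t=1$, $t'=\infty$), and $\psi(r)=(\phi(r))^{p/q}$.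
   Context: Notation: $\mathbb{R}^+=(0,\infty)$; $\alpha\ge-\frac12$ is a fixed real number; $d_\alpha=2\alpha+2$; $d\mu_\alpha(x)=A_\alpha|x|^{2\alpha+1}dx$ on $\mathbb{R}$ with $A_\alpha=(2^{\alpha+1}\Gamma(\alpha+1))^{-1}$; $B(0,r)=(-r,r)$; $L^t(\mathbb{R},d\mu_\alpha)$ is the usual Lebesgue space of $\mu_\alpha$. Dunkl translation: for $x,y\in\mathbb{R}$ and $\theta\in[0,\pi]$ put $(x,y)_\theta=\sqrt{x^2+y^2-2xy\cos\theta}$. For a function $g$ on $\mathbb{R}$ (continuous, or locally integrable with respect to $\mu_\alpha$, in which case the formula is understood for almost every $y$), $$\tau_x^\alpha g(y)=\frac{c_\alpha}{2}\int_0^\pi\Big\{g((x,y)_\theta)+g(-(x,y)_\theta)+\frac{x+y}{(x,y)_\theta}\big[g((x,y)_\theta)-g(-(x,y)_\theta)\big]\Big\}(1-\cos\theta)\sin^{2\alpha}\theta\,d\theta,$$ with $c_\alpha=\big(\int_0^\pi\sin^{2\alpha}\theta\,d\theta\big)^{-1}$; for $\alpha=-\frac12$ it is the ordinary translation $\tau_x^\alpha g(y)=g(x+y)$. The notation $\tau_x^\alpha|f|^p(y)$ means $(\tau_x^\alpha(|f|^p))(y)$. Generalized Dunkl-type Morrey space: for $1\le p<\infty$ and $\phi:\mathbb{R}^+\to\mathbb{R}^+$, $L^{p,\phi}(\mathbb{R},d\mu_\alpha)$ is the set of locally $p$-integrable $f$ on $\mathbb{R}$ with $$\|f\|_{L^{p,\phi}(\mathbb{R},d\mu_\alpha)}=\sup_{r>0,\,x\in\mathbb{R}}\frac1{\phi(r)}\Big(\frac1{r^{d_\alpha}}\int_{B(0,r)}\tau_x^\alpha|f|^p(y)\,d\mu_\alpha(y)\Big)^{1/p}<\infty.$$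 Dunkl-type Bessel–Riesz operator: $I_{\beta,\gamma}^\alpha f(x)=\int_{\mathbb{R}}f(y)\,\tau_x^\alpha K_{\beta,\gamma}^\alpha(y)\,d\mu_\alpha(y)$, where $K_{\beta,\gamma}^\alpha(x)=\frac{|x|^{\beta-d_\alpha}}{(1+|x|)^\gamma}$. A function $\theta:(0,\infty)\to(0,\infty)$ is almost increasing (resp. almost decreasing) if there is $C>0$ with $\theta(r)\le C\theta(s)$ (resp. $\theta(r)\ge C\theta(s)$) for all $r\le s$. *)

theory Defs
  imports "HOL-Analysis.Analysis"
begin

definition dunkl_dim :: "real \<Rightarrow> real" where
  "dunkl_dim \<alpha> = 2 * \<alpha> + 2"

text \<open>Functions are Borel measurable throughout: every almost-everywhere class of Lebesgue
  measurable functions has a Borel representative, so the spaces of classes are the usual ones.\<close>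

definition dunkl_measure :: "real \<Rightarrow> real measure" where
  "dunkl_measure \<alpha> = density lborel
     (\<lambda>x. ennreal (1 / (2 powr (\<alpha> + 1) * Gamma (\<alpha> + 1)) * \<bar>x\<bar> powr (2 * \<alpha> + 1)))"

definition dunkl_dist :: "real \<Rightarrow> real \<Rightarrow> real \<Rightarrow> real" where
  "dunkl_dist x y \<theta> = sqrt (x\<^sup>2 + y\<^sup>2 - 2 * x * y * cos \<theta>)"

definition dunkl_const :: "real \<Rightarrow> real" where
  "dunkl_const \<alpha> = inverse (LINT \<theta>:{0..pi}|lborel. sin \<theta> powr (2 * \<alpha>))"

text \<open>The total functions below take junk values where an integral diverges. For \<open>g\<close> locally
  integrable with respect to the Dunkl measure, the integral over \<open>\<theta>\<close> converges for almost
  every \<open>y\<close>. Where the distance in the denominator vanishes the quotient is \<open>0\<close>; for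
  \<open>(x, y) \<noteq> (0, 0)\<close> this concerns at most one \<open>\<theta>\<close> in \<open>[0, \<pi>]\<close>.\<close>

definition dunkl_translation :: "real \<Rightarrow> real \<Rightarrow> (real \<Rightarrow> real) \<Rightarrow> real \<Rightarrow> real" where
  "dunkl_translation \<alpha> x g y =
     (if \<alpha> = - 1 / 2 then g (x + y)
      else dunkl_const \<alpha> / 2 *
        (LINT \<theta>:{0..pi}|lborel.
           (g (dunkl_dist x y \<theta>) + g (- dunkl_dist x y \<theta>)
            + (x + y) / dunkl_dist x y \<theta> * (g (dunkl_dist x y \<theta>) - g (- dunkl_dist x y \<theta>)))
           * (1 - cos \<theta>) * sin \<theta> powr (2 * \<alpha>)))"

definition dunkl_Lnorm :: "real \<Rightarrow> real \<Rightarrow> (real \<Rightarrow> real) \<Rightarrow> ennreal" where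
  "dunkl_Lnorm \<alpha> t g =
     (let I = (\<integral>\<^sup>+ x. ennreal (\<bar>g x\<bar> powr t) \<partial>dunkl_measure \<alpha>)
      in if I = \<infinity> then \<infinity> else ennreal (enn2real I powr (1 / t)))"

definition dunkl_locally_integrable :: "real \<Rightarrow> real \<Rightarrow> (real \<Rightarrow> complex) \<Rightarrow> bool" where
  "dunkl_locally_integrable \<alpha> p f \<longleftrightarrow>
     f \<in> borel_measurable borel \<and>
     (\<forall>S. compact S \<longrightarrow> set_integrable (dunkl_measure \<alpha>) S (\<lambda>x. norm (f x) powr p))"

text \<open>The translation is not positivity preserving, but for locally \<open>p\<close>-integrable \<open>f\<close> the
  integral over the symmetric interval \<open>(-r, r)\<close> exists and is nonnegative, so that neither
  \<open>powr\<close> nor \<open>ennreal\<close> is applied to a negative number.\<close>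

definition dunkl_morrey_norm :: "real \<Rightarrow> real \<Rightarrow> (real \<Rightarrow> real) \<Rightarrow> (real \<Rightarrow> complex) \<Rightarrow> ennreal" where
  "dunkl_morrey_norm \<alpha> p \<phi> f =
     (SUP (r, x) \<in> {0<..} \<times> UNIV.
        ennreal (1 / \<phi> r *
          (1 / r powr dunkl_dim \<alpha> *
            (LINT y:{-r<..<r}|dunkl_measure \<alpha>.
               dunkl_translation \<alpha> x (\<lambda>z. norm (f z) powr p) y)) powr (1 / p)))"

definition dunkl_morrey :: "real \<Rightarrow> real \<Rightarrow> (real \<Rightarrow> real) \<Rightarrow> (real \<Rightarrow> complex) set" where
  "dunkl_morrey \<alpha> p \<phi> =
     {f. dunkl_locally_integrable \<alpha> p f \<and> dunkl_morrey_norm \<alpha> p \<phi> f < \<infinity>}"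

definition bessel_riesz_kernel :: "real \<Rightarrow> real \<Rightarrow> real \<Rightarrow> real \<Rightarrow> real" where
  "bessel_riesz_kernel \<alpha> \<beta> \<gamma> x = \<bar>x\<bar> powr (\<beta> - dunkl_dim \<alpha>) / (1 + \<bar>x\<bar>) powr \<gamma>"

definition bessel_riesz_integrand ::
    "real \<Rightarrow> real \<Rightarrow> real \<Rightarrow> (real \<Rightarrow> complex) \<Rightarrow> real \<Rightarrow> real \<Rightarrow> complex" where
  "bessel_riesz_integrand \<alpha> \<beta> \<gamma> f x y =
     f y * of_real (dunkl_translation \<alpha> x (bessel_riesz_kernel \<alpha> \<beta> \<gamma>) y)"

definition bessel_riesz :: "real \<Rightarrow> real \<Rightarrow> real \<Rightarrow> (real \<Rightarrow> complex) \<Rightarrow> real \<Rightarrow> complex" where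
  "bessel_riesz \<alpha> \<beta> \<gamma> f x = (LINT y|dunkl_measure \<alpha>. bessel_riesz_integrand \<alpha> \<beta> \<gamma> f x y)"

definition almost_increasing :: "(real \<Rightarrow> real) \<Rightarrow> bool" where
  "almost_increasing \<theta> \<longleftrightarrow> (\<exists>C>0. \<forall>r s. 0 < r \<and> r \<le> s \<longrightarrow> \<theta> r \<le> C * \<theta> s)"

definition almost_decreasing :: "(real \<Rightarrow> real) \<Rightarrow> bool" where
  "almost_decreasing \<theta> \<longleftrightarrow> (\<exists>C>0. \<forall>r s. 0 < r \<and> r \<le> s \<longrightarrow> \<theta> r \<ge> C * \<theta> s)"

end

theory Submission
  imports Defs
begin

text \<open>
  Write \<open>\<mu>\<close> for the Dunkl measure, \<open>\<rho>\<close> for \<open>dunkl_dist x y \<theta>\<close>, and \<open>\<sigma>\<close> for the probability measure of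
  density \<open>c sin \<theta> powr (2\<alpha>)\<close> on \<open>[0, \<pi>]\<close> (two atoms of mass \<open>1/2\<close> at \<open>0\<close> and \<open>\<pi>\<close> when \<open>\<alpha> = -1/2\<close>).
  The Dunkl translation does not preserve positivity, so the proof replaces its integrals by the
  positive operators
  \<open>D r g x = \<integral> g z * U r x z d\<mu>(z)\<close> with \<open>U r x z = \<sigma> {\<theta>. dunkl_dist x z \<theta> < r}\<close>,
  called \<open>ball_integral\<close> and \<open>ball_weight\<close> below.

  Geometry. In polar coordinates \<open>(u, v) = (y cos \<theta>, y sin \<theta>)\<close> the measure \<open>d\<mu>(y) d\<sigma>(\<theta>)\<close> is a multiple
  of \<open>\<bar>v\<bar> powr (2\<alpha>) du dv\<close>, and \<open>\<bar>y\<bar>\<close> and \<open>\<rho>\<close> are the distances from \<open>(u, v)\<close> to \<open>(0, 0)\<close> and \<open>(x, 0)\<close>.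
  The reflection \<open>u \<mapsto> x - u\<close> preserves the measure and exchanges the two distances
  (\<open>dunkl_exchange\<close>). Hence the total mass of \<open>U r x\<close> is \<open>\<mu> (-r, r)\<close>, of order at most \<open>r powr d\<close>. The
  integral \<open>J x\<close> of the translate of \<open>g \<ge> 0\<close> by \<open>x\<close> over \<open>(-r, r)\<close>, averaged over
  \<open>(y, \<theta>) \<mapsto> (-y, \<pi> - \<theta>)\<close>, has a nonnegative integrand, and \<open>J x + J (-x) = 2 D r g x\<close>
  (\<open>integral_translation_add\<close>). So the Morrey norm of \<open>f\<close> is comparable to the least \<open>N\<close> with
  \<open>D r (\<bar>f\<bar> powr p) x \<le> r powr d * (\<phi> r * N) powr p\<close> for all \<open>r\<close> and \<open>x\<close>.

  One scale. The triangle inequality, applied for each angle, gives \<open>D r (D s g) \<le> C s powr d * D (2 r) g\<close>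
  for \<open>s \<le> r\<close> (\<open>ball_integral_comp_le\<close>). With Jensen's inequality it follows that
  \<open>s powr (-d) * D s \<bar>f\<bar>\<close> satisfies the Morrey bound of \<open>f\<close> up to a constant, uniformly in \<open>s\<close>. It is also bounded
  pointwise by \<open>C \<phi> s * N\<close>. Taking \<open>p\<close> of \<open>q\<close> factors from the first bound and \<open>q - p\<close> from the second,
  and using \<open>\<phi> s \<le> C\<^sub>0 * s powr \<nu>\<close>, the target exponent \<open>q\<close> is exactly the one for which \<open>D s \<bar>f\<bar>\<close> has norm at most
  \<open>C s powr (d/t) * N\<close> in the target space (\<open>ball_integral_normalized_le\<close>).

  All scales. The kernel is at most \<open>coef k\<close> on the shell \<open>2\<^sup>k \<le> \<bar>z\<bar> < 2\<^sup>k\<^sup>+\<^sup>1\<close>, so \<open>\<bar>I f\<bar>\<close> is at most twice the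
  sum over \<open>k \<in> \<int>\<close> of \<open>coef k\<close> times \<open>D s \<bar>f\<bar>\<close> with \<open>s = 2\<^sup>k\<^sup>+\<^sup>1\<close>. The interval for \<open>t\<close> is open, hence
  \<open>coef k * s powr (d/t)\<close> decays geometrically as \<open>k\<close> tends to \<open>\<plusminus>\<infinity>\<close> (\<open>coef_radius_sum\<close>), and Jensen's
  inequality for the sum over \<open>k\<close> adds up the scales. Finally the norm of the kernel is a positive
  number or infinite, so it may be inserted into the bound at the price of a constant.
\<close>

section \<open>Polar coordinates with a signed radius\<close>

text \<open>The substitution \<open>u = cot \<theta>\<close>, made on compact subintervals of \<open>(0, \<pi>)\<close> that exhaust it. The
  increasing function \<open>- cot\<close> is used, as the substitution rule asks for a nonnegative derivative.\<close>

lemma nn_integral_cot: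
  fixes G :: "real \<Rightarrow> ennreal"
  assumes [measurable]: "G \<in> borel_measurable borel"
  shows "(\<integral>\<^sup>+u. G u \<partial>lborel) =
    (\<integral>\<^sup>+\<theta>. G (cos \<theta> / sin \<theta>) * ennreal (1 / (sin \<theta>)\<^sup>2) * indicator {0<..<pi} \<theta> \<partial>lborel)"
proof -
  define a where "a n = 1 / real (n + 1)" for n
  define g where "g \<theta> = - (cos \<theta> / sin \<theta>)" for \<theta> :: real
  have a_pos: "0 < a n" for n by (simp add: a_def)
  have a_le1: "a n \<le> 1" for n by (simp add: a_def)
  have a_pi: "a n < pi - a n" for n using a_le1[of n] pi_gt3 by linarith
  have a_dec: "a n \<le> a m" if "m \<le> n" for m n using that by (simp add: a_def frac_le)
  have a_arch: "\<exists>n. a n < e" if "0 < e" for e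
    unfolding a_def using that by (metis nat_approx_posE add.commute Suc_eq_plus1 of_nat_Suc)
  have sin_pos: "0 < sin \<theta>" if "\<theta> \<in> {a n..pi - a n}" for \<theta> n
    using that a_pos[of n] by (intro sin_gt_zero) auto
  have der: "(g has_real_derivative 1 / (sin \<theta>)\<^sup>2) (at \<theta>)" if "sin \<theta> \<noteq> 0" for \<theta>
  proof -
    have "(g has_real_derivative - ((- sin \<theta> * sin \<theta> - cos \<theta> * cos \<theta>) / (sin \<theta> * sin \<theta>))) (at \<theta>)"
      unfolding g_def using that by (intro DERIV_minus DERIV_divide DERIV_cos DERIV_sin)
    also have "- ((- sin \<theta> * sin \<theta> - cos \<theta> * cos \<theta>) / (sin \<theta> * sin \<theta>)) =
        ((sin \<theta>)\<^sup>2 + (cos \<theta>)\<^sup>2) / (sin \<theta>)\<^sup>2"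
      by (simp only: power2_eq_square minus_divide_left)
         (use sin_cos_squared_add[of \<theta>] in \<open>simp add: power2_eq_square\<close>)
    also have "\<dots> = 1 / (sin \<theta>)\<^sup>2" by (simp only: sin_cos_squared_add)
    finally show ?thesis .
  qed
  have sub: "(\<integral>\<^sup>+u. G (- u) * indicator {g (a n)..g (pi - a n)} u \<partial>lborel) =
     (\<integral>\<^sup>+\<theta>. G (- g \<theta>) * ennreal (1 / (sin \<theta>)\<^sup>2) * indicator {a n..pi - a n} \<theta> \<partial>lborel)" for n
  proof (rule nn_integral_substitution_aux)
    show "(g has_real_derivative 1 / (sin \<theta>)\<^sup>2) (at \<theta>)" if "\<theta> \<in> {a n..pi - a n}" for \<theta>
      using der sin_pos[OF that] by auto
    show "continuous_on {a n..pi - a n} (\<lambda>\<theta>. 1 / (sin \<theta>)\<^sup>2)"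
      using sin_pos by (force intro!: continuous_intros)
  qed (use a_pi in auto)
  \<comment> \<open>The subintervals exhaust \<open>(0, \<pi>)\<close>, and their images under \<open>g\<close> exhaust the line.\<close>
  have UN\<theta>: "(\<Union>n. {a n..pi - a n}) = {0<..<pi}"
  proof (intro subset_antisym subsetI)
    fix \<theta> assume "\<theta> \<in> {0<..<pi}"
    then obtain n where "a n < min \<theta> (pi - \<theta>)" using a_arch[of "min \<theta> (pi - \<theta>)"] by auto
    then have "\<theta> \<in> {a n..pi - a n}" by auto
    then show "\<theta> \<in> (\<Union>n. {a n..pi - a n})" by blast
  next
    fix \<theta> assume "\<theta> \<in> (\<Union>n. {a n..pi - a n})"
    then obtain n where "\<theta> \<in> {a n..pi - a n}" by blast
    then show "\<theta> \<in> {0<..<pi}" using a_pos[of n] by auto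
  qed
  have g_sym: "g (pi - \<theta>) = - g \<theta>" for \<theta> by (simp add: g_def)
  have g_mono: "g \<theta> \<le> g \<eta>" if "0 < \<theta>" "\<theta> \<le> \<eta>" "\<eta> < pi" for \<theta> \<eta>
  proof (rule DERIV_nonneg_imp_nondecreasing[OF \<open>\<theta> \<le> \<eta>\<close>])
    fix x assume "\<theta> \<le> x" "x \<le> \<eta>"
    then have "0 < sin x" using that by (intro sin_gt_zero) auto
    then show "\<exists>y. (g has_real_derivative y) (at x) \<and> 0 \<le> y"
      using der[of x] by (intro exI[of _ "1 / (sin x)\<^sup>2"]) auto
  qed
  have UNu: "(\<Union>n. {g (a n)..g (pi - a n)}) = UNIV"
  proof (intro subset_antisym subsetI UNIV_I)
    fix u :: real
    define \<theta> where "\<theta> = pi / 2 - arctan \<bar>u\<bar>"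
    have \<theta>: "0 < \<theta>" "\<theta> \<le> pi / 2" using arctan_ubound[of "\<bar>u\<bar>"] by (auto simp: \<theta>_def)
    have "g \<theta> = - \<bar>u\<bar>"
      using tan_arctan[of "\<bar>u\<bar>"] by (simp add: g_def \<theta>_def tan_def sin_diff cos_diff)
    moreover obtain n where "a n < \<theta>" using a_arch \<theta> by blast
    then have "g (a n) \<le> g \<theta>" using g_mono[of "a n" \<theta>] a_pos[of n] \<theta> pi_gt_zero by auto
    ultimately have "u \<in> {g (a n)..g (pi - a n)}" by (auto simp: g_sym)
    then show "u \<in> (\<Union>n. {g (a n)..g (pi - a n)})" by blast
  qed
  let ?Mu = "density lborel (\<lambda>u. G (- u))"
  have g_meas [measurable]: "g \<in> borel_measurable borel" unfolding g_def by measurable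
  let ?Mt = "density lborel (\<lambda>\<theta>. G (- g \<theta>) * ennreal (1 / (sin \<theta>)\<^sup>2))"
  have eq: "emeasure ?Mu {g (a n)..g (pi - a n)} = emeasure ?Mt {a n..pi - a n}" for n
    using sub[of n] by (simp add: emeasure_density)
  have "incseq (\<lambda>n. {a n..pi - a n})"
    using a_dec by (intro monoI) (fastforce)
  then have 1: "(SUP n. emeasure ?Mt {a n..pi - a n}) = emeasure ?Mt {0<..<pi}"
    unfolding UN\<theta>[symmetric] by (intro SUP_emeasure_incseq) auto
  have "g (a n) \<le> g (a m)" if "m \<le> n" for m n
    using that a_dec[of m n] a_pos[of n] a_le1[of m] pi_gt3 by (intro g_mono) auto
  then have "incseq (\<lambda>n. {g (a n)..g (pi - a n)})"
    by (intro monoI) (fastforce simp: g_sym)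
  then have 2: "(SUP n. emeasure ?Mu {g (a n)..g (pi - a n)}) = emeasure ?Mu UNIV"
    unfolding UNu[symmetric] by (intro SUP_emeasure_incseq) auto
  have "(\<integral>\<^sup>+u. G u \<partial>lborel) = (\<integral>\<^sup>+u. G (- u) \<partial>lborel)"
    using nn_integral_real_affine[of G "-1" 0] by simp
  also have "\<dots> = emeasure ?Mt {0<..<pi}"
    using 1 2 eq by (simp add: emeasure_density)
  finally show ?thesis by (simp add: emeasure_density g_def)
qed

text \<open>The radius \<open>y\<close> runs over the whole line and \<open>\<theta>\<close> over \<open>(0, \<pi>)\<close>, so every point off the axis \<open>v = 0\<close> is met
  once. The Jacobian comes from two substitutions in one variable: \<open>u = v cot \<theta>\<close> for fixed \<open>v\<close>, then
  \<open>v = y sin \<theta>\<close> for fixed \<open>\<theta>\<close>.\<close>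

lemma nn_integral_polar:
  fixes F :: "real \<times> real \<Rightarrow> ennreal"
  assumes [measurable]: "F \<in> borel_measurable (borel \<Otimes>\<^sub>M borel)"
  shows "(\<integral>\<^sup>+v. \<integral>\<^sup>+u. F (u, v) \<partial>lborel \<partial>lborel) =
    (\<integral>\<^sup>+y. \<integral>\<^sup>+\<theta>. F (y * cos \<theta>, y * sin \<theta>) * ennreal \<bar>y\<bar> * indicator {0<..<pi} \<theta> \<partial>lborel \<partial>lborel)"
proof -
  have scale: "(\<integral>\<^sup>+u. F (u, v) \<partial>lborel) = (\<integral>\<^sup>+\<theta>. F (v * (cos \<theta> / sin \<theta>), v) *
      ennreal (\<bar>v\<bar> / (sin \<theta>)\<^sup>2) * indicator {0<..<pi} \<theta> \<partial>lborel)" if "v \<noteq> 0" for v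
  proof -
    have "(\<integral>\<^sup>+u. F (u, v) \<partial>lborel) = ennreal \<bar>v\<bar> * (\<integral>\<^sup>+u. F (v * u, v) \<partial>lborel)"
      using nn_integral_real_affine[of "\<lambda>u. F (u, v)" v 0] that by simp
    also have "\<dots> = ennreal \<bar>v\<bar> * (\<integral>\<^sup>+\<theta>. F (v * (cos \<theta> / sin \<theta>), v) *
        ennreal (1 / (sin \<theta>)\<^sup>2) * indicator {0<..<pi} \<theta> \<partial>lborel)"
      by (subst nn_integral_cot) auto
    also have "\<dots> = (\<integral>\<^sup>+\<theta>. ennreal \<bar>v\<bar> * (F (v * (cos \<theta> / sin \<theta>), v) *
        ennreal (1 / (sin \<theta>)\<^sup>2) * indicator {0<..<pi} \<theta>) \<partial>lborel)"
      by (subst nn_integral_cmult) auto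
    also have "\<dots> = (\<integral>\<^sup>+\<theta>. F (v * (cos \<theta> / sin \<theta>), v) *
        ennreal (\<bar>v\<bar> / (sin \<theta>)\<^sup>2) * indicator {0<..<pi} \<theta> \<partial>lborel)"
    proof (intro nn_integral_cong)
      fix \<theta>
      have "ennreal (\<bar>v\<bar> / (sin \<theta>)\<^sup>2) = ennreal \<bar>v\<bar> * ennreal (1 / (sin \<theta>)\<^sup>2)"
        by (subst ennreal_mult[symmetric]) auto
      then show "ennreal \<bar>v\<bar> * (F (v * (cos \<theta> / sin \<theta>), v) *
        ennreal (1 / (sin \<theta>)\<^sup>2) * indicator {0<..<pi} \<theta>) = F (v * (cos \<theta> / sin \<theta>), v) *
        ennreal (\<bar>v\<bar> / (sin \<theta>)\<^sup>2) * indicator {0<..<pi} \<theta>" by (simp add: mult_ac)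
    qed
    finally show ?thesis .
  qed
  have radial: "(\<integral>\<^sup>+v. F (v * (cos \<theta> / sin \<theta>), v) * ennreal (\<bar>v\<bar> / (sin \<theta>)\<^sup>2) \<partial>lborel)
      = (\<integral>\<^sup>+y. F (y * cos \<theta>, y * sin \<theta>) * ennreal \<bar>y\<bar> \<partial>lborel)" if "\<theta> \<in> {0<..<pi}" for \<theta>
  proof -
    have s: "0 < sin \<theta>" using that by (intro sin_gt_zero) auto
    have "(\<integral>\<^sup>+v. F (v * (cos \<theta> / sin \<theta>), v) * ennreal (\<bar>v\<bar> / (sin \<theta>)\<^sup>2) \<partial>lborel)
      = ennreal (sin \<theta>) * (\<integral>\<^sup>+y. F (sin \<theta> * y * (cos \<theta> / sin \<theta>), sin \<theta> * y) *
          ennreal (\<bar>sin \<theta> * y\<bar> / (sin \<theta>)\<^sup>2) \<partial>lborel)"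
      using nn_integral_real_affine[of "\<lambda>v. F (v * (cos \<theta> / sin \<theta>), v) * ennreal (\<bar>v\<bar> / (sin \<theta>)\<^sup>2)" "sin \<theta>" 0] s
      by simp
    also have "\<dots> = (\<integral>\<^sup>+y. ennreal (sin \<theta>) * (F (sin \<theta> * y * (cos \<theta> / sin \<theta>), sin \<theta> * y) *
          ennreal (\<bar>sin \<theta> * y\<bar> / (sin \<theta>)\<^sup>2)) \<partial>lborel)"
      by (subst nn_integral_cmult) auto
    also have "\<dots> = (\<integral>\<^sup>+y. F (y * cos \<theta>, y * sin \<theta>) * ennreal \<bar>y\<bar> \<partial>lborel)"
    proof (intro nn_integral_cong)
      fix y
      have "ennreal (sin \<theta>) * ennreal (\<bar>sin \<theta> * y\<bar> / (sin \<theta>)\<^sup>2) = ennreal \<bar>y\<bar>"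
        using s by (subst ennreal_mult[symmetric]) (auto simp: abs_mult power2_eq_square)
      moreover have "sin \<theta> * y * (cos \<theta> / sin \<theta>) = y * cos \<theta>" using s by simp
      ultimately show "ennreal (sin \<theta>) * (F (sin \<theta> * y * (cos \<theta> / sin \<theta>), sin \<theta> * y) *
          ennreal (\<bar>sin \<theta> * y\<bar> / (sin \<theta>)\<^sup>2)) = F (y * cos \<theta>, y * sin \<theta>) * ennreal \<bar>y\<bar>"
        by (metis mult.commute mult.left_commute)
    qed
    finally show ?thesis .
  qed
  have "(\<integral>\<^sup>+v. \<integral>\<^sup>+u. F (u, v) \<partial>lborel \<partial>lborel) = (\<integral>\<^sup>+v. \<integral>\<^sup>+\<theta>. F (v * (cos \<theta> / sin \<theta>), v) *
      ennreal (\<bar>v\<bar> / (sin \<theta>)\<^sup>2) * indicator {0<..<pi} \<theta> \<partial>lborel \<partial>lborel)"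
  proof (rule nn_integral_cong_AE)
    have "AE v in lborel. v \<noteq> (0::real)" by (rule AE_lborel_singleton)
    then show "AE v in lborel. (\<integral>\<^sup>+u. F (u, v) \<partial>lborel) = (\<integral>\<^sup>+\<theta>. F (v * (cos \<theta> / sin \<theta>), v) *
      ennreal (\<bar>v\<bar> / (sin \<theta>)\<^sup>2) * indicator {0<..<pi} \<theta> \<partial>lborel)"
      by eventually_elim (rule scale)
  qed
  also have "\<dots> = (\<integral>\<^sup>+\<theta>. \<integral>\<^sup>+v. F (v * (cos \<theta> / sin \<theta>), v) *
      ennreal (\<bar>v\<bar> / (sin \<theta>)\<^sup>2) * indicator {0<..<pi} \<theta> \<partial>lborel \<partial>lborel)"
    by (rule lborel_pair.Fubini') measurable
  also have "\<dots> = (\<integral>\<^sup>+\<theta>. \<integral>\<^sup>+y. F (y * cos \<theta>, y * sin \<theta>) * ennreal \<bar>y\<bar> *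
      indicator {0<..<pi} \<theta> \<partial>lborel \<partial>lborel)"
  proof (rule nn_integral_cong)
    fix \<theta> :: real
    show "(\<integral>\<^sup>+v. F (v * (cos \<theta> / sin \<theta>), v) *
      ennreal (\<bar>v\<bar> / (sin \<theta>)\<^sup>2) * indicator {0<..<pi} \<theta> \<partial>lborel) = (\<integral>\<^sup>+y. F (y * cos \<theta>, y * sin \<theta>) *
      ennreal \<bar>y\<bar> * indicator {0<..<pi} \<theta> \<partial>lborel)"
      using radial[of \<theta>] by (cases "\<theta> \<in> {0<..<pi}") auto
  qed
  also have "\<dots> = (\<integral>\<^sup>+y. \<integral>\<^sup>+\<theta>. F (y * cos \<theta>, y * sin \<theta>) * ennreal \<bar>y\<bar> *
      indicator {0<..<pi} \<theta> \<partial>lborel \<partial>lborel)"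
    by (rule lborel_pair.Fubini') measurable
  finally show ?thesis .
qed

section \<open>The Dunkl measure and the angular measure\<close>

definition dunkl_density :: "real \<Rightarrow> real \<Rightarrow> real" where
  "dunkl_density \<alpha> y = 1 / (2 powr (\<alpha> + 1) * Gamma (\<alpha> + 1)) * \<bar>y\<bar> powr (2 * \<alpha> + 1)"

lemma dunkl_measure_eq: "dunkl_measure \<alpha> = density lborel (\<lambda>y. ennreal (dunkl_density \<alpha> y))"
  by (simp add: dunkl_measure_def dunkl_density_def)

lemma borel_measurable_dunkl_density [measurable]: "dunkl_density \<alpha> \<in> borel_measurable borel"
  unfolding dunkl_density_def by measurable

lemma sets_dunkl_measure [simp, measurable_cong]: "sets (dunkl_measure \<alpha>) = sets borel"
  by (simp add: dunkl_measure_def)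

lemma space_dunkl_measure [simp]: "space (dunkl_measure \<alpha>) = UNIV"
  by (simp add: dunkl_measure_def)

lemma dunkl_density_uminus [simp]: "dunkl_density \<alpha> (- y) = dunkl_density \<alpha> y"
  by (simp add: dunkl_density_def)

lemma dunkl_density_nonneg [simp]: "-1/2 \<le> \<alpha> \<Longrightarrow> 0 \<le> dunkl_density \<alpha> y"
  by (auto simp: dunkl_density_def intro!: mult_nonneg_nonneg divide_nonneg_nonneg Gamma_real_nonneg)

lemma dunkl_density_pos: "-1/2 \<le> \<alpha> \<Longrightarrow> y \<noteq> 0 \<Longrightarrow> 0 < dunkl_density \<alpha> y"
  by (auto simp: dunkl_density_def intro!: divide_pos_pos mult_pos_pos Gamma_real_pos)

lemma nn_integral_dunkl_measure:
  "f \<in> borel_measurable borel \<Longrightarrow>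
    (\<integral>\<^sup>+y. f y \<partial>dunkl_measure \<alpha>) = (\<integral>\<^sup>+y. ennreal (dunkl_density \<alpha> y) * f y \<partial>lborel)"
  by (simp add: dunkl_measure_eq nn_integral_density)

lemma sigma_finite_dunkl_measure: "sigma_finite_measure (dunkl_measure \<alpha>)"
  unfolding dunkl_measure_eq
  by (subst sigma_finite_measure.sigma_finite_iff_density_finite'[OF lborel.sigma_finite_measure_axioms]) auto

lemma distr_dunkl_measure_uminus: "distr (dunkl_measure \<alpha>) borel uminus = dunkl_measure \<alpha>"
proof (rule measure_eqI)
  fix X assume "X \<in> sets (distr (dunkl_measure \<alpha>) borel uminus)"
  then have [measurable]: "X \<in> sets borel" by simp
  have "emeasure (distr (dunkl_measure \<alpha>) borel uminus) X =
      (\<integral>\<^sup>+y. ennreal (dunkl_density \<alpha> y) * indicator X (- y) \<partial>lborel)"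
  proof -
    have "emeasure (distr (dunkl_measure \<alpha>) borel uminus) X =
        (\<integral>\<^sup>+y. indicator X y \<partial>distr (dunkl_measure \<alpha>) borel uminus)"
      by simp
    also have "\<dots> = (\<integral>\<^sup>+y. indicator X (- y) \<partial>dunkl_measure \<alpha>)"
      by (rule nn_integral_distr) auto
    finally show ?thesis by (simp add: nn_integral_dunkl_measure)
  qed
  also have "\<dots> = (\<integral>\<^sup>+y. ennreal (dunkl_density \<alpha> y) * indicator X y \<partial>lborel)"
    using nn_integral_real_affine[of "\<lambda>y. ennreal (dunkl_density \<alpha> y) * indicator X y" "-1" 0]
    by simp
  also have "\<dots> = emeasure (dunkl_measure \<alpha>) X"
    by (subst nn_integral_dunkl_measure[symmetric]) auto
  finally show "emeasure (distr (dunkl_measure \<alpha>) borel uminus) X = emeasure (dunkl_measure \<alpha>) X" .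
qed simp

text \<open>As \<open>2\<alpha> + 1 \<ge> 0\<close>, the density on the interval is at most its value at the end point \<open>r\<close>.\<close>

lemma emeasure_dunkl_ball_le:
  assumes "-1/2 \<le> \<alpha>" "0 < r"
  shows "emeasure (dunkl_measure \<alpha>) {-r<..<r}
    \<le> ennreal (2 * dunkl_density \<alpha> 1 * r powr dunkl_dim \<alpha>)"
proof -
  have "emeasure (dunkl_measure \<alpha>) {-r<..<r} =
      (\<integral>\<^sup>+y. ennreal (dunkl_density \<alpha> y) * indicator {-r<..<r} y \<partial>lborel)"
    by (subst nn_integral_dunkl_measure[symmetric]) auto
  also have "\<dots> \<le> (\<integral>\<^sup>+y. ennreal (dunkl_density \<alpha> r) * indicator {-r<..<r} y \<partial>lborel)"
    using assms
    by (intro nn_integral_mono)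
       (auto simp: indicator_def dunkl_density_def intro!: ennreal_leI mult_left_mono divide_right_mono powr_mono2
          Gamma_real_nonneg divide_nonneg_nonneg)
  also have "\<dots> = ennreal (dunkl_density \<alpha> r) * ennreal (2 * r)"
    using assms by (simp add: nn_integral_cmult)
  also have "\<dots> = ennreal (2 * dunkl_density \<alpha> 1 * r powr dunkl_dim \<alpha>)"
  proof -
    have "r powr dunkl_dim \<alpha> = r powr (2 * \<alpha> + 1) * r"
      using assms powr_add[of r "2 * \<alpha> + 1" 1] by (simp add: dunkl_dim_def add.commute)
    then show ?thesis using assms
      by (subst ennreal_mult[symmetric]) (auto simp: dunkl_density_def)
  qed
  finally show ?thesis .
qed

text \<open>For \<open>\<alpha> < 0\<close> both end points are singular. The integral of \<open>\<bar>v\<bar> powr (2\<alpha>)\<close> over the square \<open>[-1, 1]\<^sup>2\<close> is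
  finite because \<open>2\<alpha> > -1\<close>, and in polar coordinates its part with \<open>1/2 \<le> y \<le> 1\<close> dominates a positive
  multiple of the integral in question.\<close>

lemma sin_powr_integrable:
  assumes "-1/2 < \<alpha>"
  shows "set_integrable lborel {0..pi} (\<lambda>\<theta>. sin \<theta> powr (2 * \<alpha>))"
proof -
  let ?a = "2 * \<alpha>"
  define F :: "real \<times> real \<Rightarrow> ennreal"
    where "F = (\<lambda>(u, v). indicator {-1..1} u * (indicator {-1..1} v * ennreal (\<bar>v\<bar> powr ?a)))"
  have [measurable]: "F \<in> borel_measurable (borel \<Otimes>\<^sub>M borel)"
    unfolding F_def by measurable
  have pos: "(\<integral>\<^sup>+v. indicator {0..1} v * ennreal (\<bar>v\<bar> powr ?a) \<partial>lborel) < \<infinity>"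
  proof -
    have "(\<integral>\<^sup>+v. ennreal (v powr ?a) * indicator {0..1} v \<partial>lborel) = ennreal (1 powr (?a + 1) / (?a + 1))"
      using assms by (intro nn_integral_has_integral_lebesgue' has_integral_powr_from_0) auto
    moreover have "(\<integral>\<^sup>+v. indicator {0..1} v * ennreal (\<bar>v\<bar> powr ?a) \<partial>lborel) =
        (\<integral>\<^sup>+v. ennreal (v powr ?a) * indicator {0..1} v \<partial>lborel)"
      by (intro nn_integral_cong) (auto simp: indicator_def)
    ultimately show ?thesis by simp
  qed
  have "(\<integral>\<^sup>+v. indicator {-1..1} v * ennreal (\<bar>v\<bar> powr ?a) \<partial>lborel) \<le>
      (\<integral>\<^sup>+v. indicator {0..1} v * ennreal (\<bar>v\<bar> powr ?a) +
        indicator {0..1} (- v) * ennreal (\<bar>- v\<bar> powr ?a) \<partial>lborel)"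
    by (intro nn_integral_mono) (auto simp: indicator_def)
  also have "\<dots> = (\<integral>\<^sup>+v. indicator {0..1} v * ennreal (\<bar>v\<bar> powr ?a) \<partial>lborel) +
      (\<integral>\<^sup>+v. indicator {0..1} (- v) * ennreal (\<bar>- v\<bar> powr ?a) \<partial>lborel)"
    by (rule nn_integral_add) auto
  also have "\<dots> < \<infinity>"
    using pos nn_integral_real_affine[of "\<lambda>v. indicator {0..1} v * ennreal (\<bar>v\<bar> powr ?a)" "-1" 0]
    by (simp del: abs_minus_cancel)
  finally have fin: "(\<integral>\<^sup>+v. indicator {-1..1} v * ennreal (\<bar>v\<bar> powr ?a) \<partial>lborel) < \<infinity>" .
  define I where "I = (\<integral>\<^sup>+\<theta>. ennreal (sin \<theta> powr ?a) * indicator {0<..<pi} \<theta> \<partial>lborel)"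
  have "(\<integral>\<^sup>+y. ennreal ((1/2) powr (?a + 1)) * indicator {1/2..(1::real)} y * I \<partial>lborel)
      \<le> (\<integral>\<^sup>+y. \<integral>\<^sup>+\<theta>. F (y * cos \<theta>, y * sin \<theta>) * ennreal \<bar>y\<bar> * indicator {0<..<pi} \<theta> \<partial>lborel \<partial>lborel)"
  proof (rule nn_integral_mono)
    fix y :: real
    show "ennreal ((1/2) powr (?a + 1)) * indicator {1/2..1} y * I
      \<le> (\<integral>\<^sup>+\<theta>. F (y * cos \<theta>, y * sin \<theta>) * ennreal \<bar>y\<bar> * indicator {0<..<pi} \<theta> \<partial>lborel)"
    proof (cases "y \<in> {1/2..1}")
      case True
      have "ennreal ((1/2) powr (?a + 1)) * I =
          (\<integral>\<^sup>+\<theta>. ennreal ((1/2) powr (?a + 1)) * (ennreal (sin \<theta> powr ?a) * indicator {0<..<pi} \<theta>) \<partial>lborel)"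
        unfolding I_def by (subst nn_integral_cmult) auto
      also have "\<dots> \<le> (\<integral>\<^sup>+\<theta>. F (y * cos \<theta>, y * sin \<theta>) * ennreal \<bar>y\<bar> * indicator {0<..<pi} \<theta> \<partial>lborel)"
      proof (rule nn_integral_mono)
        fix \<theta> :: real
        show "ennreal ((1/2) powr (?a + 1)) * (ennreal (sin \<theta> powr ?a) * indicator {0<..<pi} \<theta>)
          \<le> F (y * cos \<theta>, y * sin \<theta>) * ennreal \<bar>y\<bar> * indicator {0<..<pi} \<theta>"
        proof (cases "\<theta> \<in> {0<..<pi}")
          case t: True
          then have s: "0 < sin \<theta>" by (intro sin_gt_zero) auto
          have "\<bar>y * cos \<theta>\<bar> \<le> 1 * 1" "\<bar>y * sin \<theta>\<bar> \<le> 1 * 1"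
            unfolding abs_mult using True by (intro mult_mono; simp)+
          then have "F (y * cos \<theta>, y * sin \<theta>) * ennreal \<bar>y\<bar> = ennreal (\<bar>y * sin \<theta>\<bar> powr ?a * y)"
            using True by (auto simp: F_def abs_le_iff ennreal_mult)
          also have "\<bar>y * sin \<theta>\<bar> powr ?a * y = y powr (?a + 1) * sin \<theta> powr ?a"
            using True s by (simp add: powr_mult abs_mult powr_add)
          finally have "F (y * cos \<theta>, y * sin \<theta>) * ennreal \<bar>y\<bar> = ennreal (y powr (?a + 1) * sin \<theta> powr ?a)" .
          moreover have "(1/2) powr (?a + 1) \<le> y powr (?a + 1)"
            using True assms by (intro powr_mono2) auto
          ultimately show ?thesis using t s
            by (auto simp: ennreal_mult[symmetric] intro!: ennreal_leI mult_right_mono)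
        qed simp
      qed
      finally show ?thesis using True by simp
    qed simp
  qed
  also have "\<dots> = (\<integral>\<^sup>+v. \<integral>\<^sup>+u. F (u, v) \<partial>lborel \<partial>lborel)"
    by (rule nn_integral_polar[symmetric]) measurable
  also have "\<dots> = (\<integral>\<^sup>+v. 2 * (indicator {-1..1} v * ennreal (\<bar>v\<bar> powr ?a)) \<partial>lborel)"
    by (simp add: F_def nn_integral_multc)
  also have "\<dots> = 2 * (\<integral>\<^sup>+v. indicator {-1..1} v * ennreal (\<bar>v\<bar> powr ?a) \<partial>lborel)"
    by (rule nn_integral_cmult) measurable
  also have "\<dots> < \<infinity>" using fin by (simp add: ennreal_mult_less_top)
  finally have "ennreal ((1/2) powr (?a + 1)) * ennreal (1 / 2) * I < \<infinity>"
    by (simp add: nn_integral_multc nn_integral_cmult)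
  then have I: "I < \<infinity>"
    by (auto simp: ennreal_mult_less_top ennreal_mult[symmetric])
  have "(\<integral>\<^sup>+\<theta>. ennreal (norm (indicator {0..pi} \<theta> *\<^sub>R sin \<theta> powr ?a)) \<partial>lborel) = I"
    unfolding I_def
    by (intro nn_integral_cong) (auto simp: indicator_def order_less_le)
  then show ?thesis
    unfolding set_integrable_def using I by (intro integrableI_bounded) auto
qed

text \<open>The law of the angle in the translation formula. As \<open>\<alpha>\<close> decreases to \<open>-1/2\<close>, the normalized weights
  concentrate at the end points of \<open>[0, \<pi>]\<close> with mass \<open>1/2\<close> each; taking this limit for \<open>\<alpha> = -1/2\<close> makes
  the ordinary translation an instance of the general formula.\<close>

definition angular_measure :: "real \<Rightarrow> real measure" where
  "angular_measure \<alpha> =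
     (if \<alpha> = - 1 / 2 then distr (point_measure {0, pi} (\<lambda>_. ennreal (1 / 2))) borel (\<lambda>\<theta>. \<theta>)
      else density lborel (\<lambda>\<theta>. ennreal (indicator {0..pi} \<theta> * (dunkl_const \<alpha> * sin \<theta> powr (2 * \<alpha>)))))"

lemma sets_angular_measure [simp, measurable_cong]: "sets (angular_measure \<alpha>) = sets borel"
  by (simp add: angular_measure_def)

lemma space_angular_measure [simp]: "space (angular_measure \<alpha>) = UNIV"
  by (simp add: angular_measure_def)

lemma nn_integral_angular_half:
  assumes "\<alpha> = - 1 / 2" and [measurable]: "h \<in> borel_measurable borel"
  shows "(\<integral>\<^sup>+\<theta>. h \<theta> \<partial>angular_measure \<alpha>) = ennreal (1 / 2) * (h 0 + h pi)"
proof -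
  have "(\<integral>\<^sup>+\<theta>. h \<theta> \<partial>angular_measure \<alpha>) = (\<integral>\<^sup>+\<theta>. h \<theta> \<partial>point_measure {0, pi} (\<lambda>_. ennreal (1 / 2)))"
    unfolding angular_measure_def using assms by (subst if_P) (auto simp: nn_integral_distr)
  also have "\<dots> = (\<Sum>\<theta>\<in>{0, pi}. ennreal (1 / 2) * h \<theta>)"
    by (subst nn_integral_point_measure_finite) (auto simp: mult.commute)
  also have "\<dots> = ennreal (1 / 2) * (h 0 + h pi)"
    unfolding sum_distrib_left[symmetric] by simp
  finally show ?thesis .
qed

lemma nn_integral_angular:
  assumes "\<alpha> \<noteq> - 1 / 2" and [measurable]: "h \<in> borel_measurable borel"
  shows "(\<integral>\<^sup>+\<theta>. h \<theta> \<partial>angular_measure \<alpha>) =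
    (\<integral>\<^sup>+\<theta>. ennreal (indicator {0..pi} \<theta> * (dunkl_const \<alpha> * sin \<theta> powr (2 * \<alpha>))) * h \<theta> \<partial>lborel)"
  using assms by (simp add: angular_measure_def nn_integral_density)

lemma integral_angular_half:
  fixes h :: "real \<Rightarrow> real"
  assumes "\<alpha> = - 1 / 2" and [measurable]: "h \<in> borel_measurable borel"
  shows "(\<integral>\<theta>. h \<theta> \<partial>angular_measure \<alpha>) = 1 / 2 * (h 0 + h pi)"
proof -
  have "(\<integral>\<theta>. h \<theta> \<partial>angular_measure \<alpha>) = (\<integral>\<theta>. h \<theta> \<partial>point_measure {0, pi} (\<lambda>_. ennreal (1 / 2)))"
    unfolding angular_measure_def using assms by (subst if_P) (auto simp: integral_distr)
  also have "\<dots> = (\<Sum>\<theta>\<in>{0, pi}. (1 / 2) *\<^sub>R h \<theta>)"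
    by (rule lebesgue_integral_point_measure_finite) auto
  also have "\<dots> = 1 / 2 * (h 0 + h pi)"
    by simp
  finally show ?thesis .
qed

lemma dunkl_const_pos:
  assumes "-1/2 < \<alpha>"
  shows "0 < (LINT \<theta>:{0..pi}|lborel. sin \<theta> powr (2 * \<alpha>))" "0 < dunkl_const \<alpha>"
proof -
  let ?I = "LINT \<theta>:{0..pi}|lborel. sin \<theta> powr (2 * \<alpha>)"
  have "0 \<le> ?I" unfolding set_lebesgue_integral_def by (intro integral_nonneg_AE) auto
  moreover have "?I \<noteq> 0"
  proof
    assume "?I = 0"
    then have "AE \<theta> in lborel. indicator {0..pi} \<theta> *\<^sub>R sin \<theta> powr (2 * \<alpha>) = 0"
      using sin_powr_integrable[OF assms] unfolding set_lebesgue_integral_def set_integrable_def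
      by (subst (asm) integral_nonneg_eq_0_iff_AE) auto
    then have "AE \<theta> in lborel. \<theta> \<notin> {0<..<pi}"
    proof eventually_elim
      case (elim \<theta>)
      then show ?case using sin_gt_zero[of \<theta>] by (auto simp: indicator_def)
    qed
    then have "emeasure lborel {0<..<pi} = 0"
      by (subst (asm) AE_iff_measurable[where N = "{0<..<pi}"]) auto
    then show False by (simp add: pi_gt_zero not_le)
  qed
  ultimately show "0 < ?I" by simp
  then show "0 < dunkl_const \<alpha>" by (simp add: dunkl_const_def)
qed

lemma emeasure_angular_measure_UNIV [simp]:
  assumes "-1/2 \<le> \<alpha>"
  shows "emeasure (angular_measure \<alpha>) UNIV = 1"
proof (cases "\<alpha> = - 1 / 2")
  case True
  have "emeasure (angular_measure \<alpha>) UNIV = ennreal (1/2) * (1 + 1)"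
    using nn_integral_angular_half[OF True, of "\<lambda>_. 1"] by simp
  also have "\<dots> = ennreal (1/2 * 2)"
    by (subst ennreal_mult) auto
  finally show ?thesis by simp
next
  case False
  then have a: "-1/2 < \<alpha>" using assms by simp
  note c = dunkl_const_pos[OF a]
  let ?w = "\<lambda>\<theta>. indicator {0..pi} \<theta> *\<^sub>R sin \<theta> powr (2 * \<alpha>)"
  have "emeasure (angular_measure \<alpha>) UNIV =
      (\<integral>\<^sup>+\<theta>. ennreal (dunkl_const \<alpha>) * ennreal (?w \<theta>) \<partial>lborel)"
    using nn_integral_angular[OF False, of "\<lambda>_. 1"] c
    by (simp add: ennreal_mult[symmetric] mult_ac)
  also have "\<dots> = ennreal (dunkl_const \<alpha>) * (\<integral>\<^sup>+\<theta>. ennreal (?w \<theta>) \<partial>lborel)"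
    by (rule nn_integral_cmult) auto
  also have "(\<integral>\<^sup>+\<theta>. ennreal (?w \<theta>) \<partial>lborel) = ennreal (LINT \<theta>:{0..pi}|lborel. sin \<theta> powr (2 * \<alpha>))"
    using sin_powr_integrable[OF a] unfolding set_lebesgue_integral_def set_integrable_def
    by (intro nn_integral_eq_integral) auto
  also have "ennreal (dunkl_const \<alpha>) * \<dots> = 1"
    using c by (subst ennreal_mult[symmetric]) (auto simp: dunkl_const_def)
  finally show ?thesis .
qed

lemma sigma_finite_angular_measure: "-1/2 \<le> \<alpha> \<Longrightarrow> sigma_finite_measure (angular_measure \<alpha>)"
proof -
  assume "-1/2 \<le> \<alpha>"
  then interpret finite_measure "angular_measure \<alpha>" by (intro finite_measureI) simp
  show ?thesis by unfold_locales
qed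

lemma distr_angular_measure_reflect: "distr (angular_measure \<alpha>) borel (\<lambda>\<theta>. pi - \<theta>) = angular_measure \<alpha>"
proof (rule measure_eqI)
  fix X assume "X \<in> sets (distr (angular_measure \<alpha>) borel (\<lambda>\<theta>. pi - \<theta>))"
  then have [measurable]: "X \<in> sets borel" by simp
  have "emeasure (distr (angular_measure \<alpha>) borel (\<lambda>\<theta>. pi - \<theta>)) X =
      (\<integral>\<^sup>+\<theta>. indicator X \<theta> \<partial>distr (angular_measure \<alpha>) borel (\<lambda>\<theta>. pi - \<theta>))"
    by simp
  also have "\<dots> = (\<integral>\<^sup>+\<theta>. indicator X (pi - \<theta>) \<partial>angular_measure \<alpha>)"
    by (rule nn_integral_distr) auto
  also have "\<dots> = (\<integral>\<^sup>+\<theta>. indicator X \<theta> \<partial>angular_measure \<alpha>)"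
  proof (cases "\<alpha> = - 1 / 2")
    case True
    show ?thesis by (subst (1 2) nn_integral_angular_half[OF True]) (auto simp: add.commute)
  next
    case False
    have "indicator {0..pi} (pi - \<theta>) = (indicator {0..pi} \<theta> :: real)" for \<theta>
      by (auto simp: indicator_def)
    then show ?thesis
      using False nn_integral_real_affine[of "\<lambda>\<theta>. ennreal (indicator {0..pi} \<theta> *
          (dunkl_const \<alpha> * sin \<theta> powr (2 * \<alpha>))) * indicator X \<theta>" "-1" pi]
      by (subst (1 2) nn_integral_angular[OF False]) auto
  qed
  also have "\<dots> = emeasure (angular_measure \<alpha>) X" by simp
  finally show "emeasure (distr (angular_measure \<alpha>) borel (\<lambda>\<theta>. pi - \<theta>)) X = emeasure (angular_measure \<alpha>) X" .
qed simp

lemma nn_integral_angular_reflect: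
  assumes [measurable]: "h \<in> borel_measurable borel"
  shows "(\<integral>\<^sup>+\<theta>. h (pi - \<theta>) \<partial>angular_measure \<alpha>) = (\<integral>\<^sup>+\<theta>. h \<theta> \<partial>angular_measure \<alpha>)"
  by (subst (2) distr_angular_measure_reflect[symmetric]) (simp add: nn_integral_distr)

lemma nn_integral_dunkl_uminus:
  assumes [measurable]: "h \<in> borel_measurable borel"
  shows "(\<integral>\<^sup>+y. h (- y) \<partial>dunkl_measure \<alpha>) = (\<integral>\<^sup>+y. h y \<partial>dunkl_measure \<alpha>)"
  by (subst (2) distr_dunkl_measure_uminus[symmetric]) (simp add: nn_integral_distr)

section \<open>The exchange identity\<close>

lemma dunkl_dist_0: "dunkl_dist x y 0 = \<bar>x - y\<bar>"
  by (simp add: dunkl_dist_def power2_diff[symmetric])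

lemma dunkl_dist_pi: "dunkl_dist x y pi = \<bar>x + y\<bar>"
  by (simp add: dunkl_dist_def power2_sum[symmetric])

text \<open>The distance between \<open>(x, 0)\<close> and the point with polar coordinates \<open>(y, \<theta>)\<close>.\<close>

lemma dunkl_dist_polar: "dunkl_dist x y \<theta> = sqrt ((x - y * cos \<theta>)\<^sup>2 + (y * sin \<theta>)\<^sup>2)"
proof -
  have "(x - y * cos \<theta>)\<^sup>2 + (y * sin \<theta>)\<^sup>2 = x\<^sup>2 + y\<^sup>2 * ((sin \<theta>)\<^sup>2 + (cos \<theta>)\<^sup>2) - 2 * x * y * cos \<theta>"
    by (simp add: power2_diff power_mult_distrib distrib_left del: sin_cos_squared_add)
  then show ?thesis by (simp add: dunkl_dist_def)
qed

lemma dunkl_dist_measurable [measurable (raw)]: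
  assumes [measurable]: "x \<in> borel_measurable M" "y \<in> borel_measurable M" "\<theta> \<in> borel_measurable M"
  shows "(\<lambda>w. dunkl_dist (x w) (y w) (\<theta> w)) \<in> borel_measurable M"
  unfolding dunkl_dist_def by measurable

lemma dunkl_dist_reflect: "dunkl_dist x y (pi - \<theta>) = dunkl_dist x (- y) \<theta>"
  "dunkl_dist (- x) y \<theta> = dunkl_dist x (- y) \<theta>"
  by (simp_all add: dunkl_dist_def)

lemma dunkl_dist_nonneg [simp]: "0 \<le> dunkl_dist x y \<theta>"
  by (simp add: dunkl_dist_polar)

lemma dunkl_dist_commute: "dunkl_dist x y \<theta> = dunkl_dist y x \<theta>"
  by (simp add: dunkl_dist_def algebra_simps)

text \<open>The density \<open>\<bar>y\<bar> powr (2\<alpha> + 1) * sin \<theta> powr (2\<alpha>)\<close> splits into the Jacobian \<open>\<bar>y\<bar>\<close> and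
  \<open>\<bar>y sin \<theta>\<bar> powr (2\<alpha>) = \<bar>v\<bar> powr (2\<alpha>)\<close>.\<close>

lemma nn_integral_dunkl_polar:
  fixes \<Phi> :: "real \<times> real \<Rightarrow> ennreal"
  assumes "-1/2 < \<alpha>" and [measurable]: "\<Phi> \<in> borel_measurable (borel \<Otimes>\<^sub>M borel)"
  shows "(\<integral>\<^sup>+y. \<integral>\<^sup>+\<theta>. \<Phi> (y * cos \<theta>, y * sin \<theta>) \<partial>angular_measure \<alpha> \<partial>dunkl_measure \<alpha>) =
    (\<integral>\<^sup>+v. \<integral>\<^sup>+u. \<Phi> (u, v) * ennreal (dunkl_const \<alpha> * dunkl_density \<alpha> 1 * \<bar>v\<bar> powr (2 * \<alpha>)) \<partial>lborel \<partial>lborel)"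
    (is "_ = (\<integral>\<^sup>+v. \<integral>\<^sup>+u. \<Phi> (u, v) * ?w v \<partial>lborel \<partial>lborel)")
proof -
  interpret ang: sigma_finite_measure "angular_measure \<alpha>"
    using assms by (intro sigma_finite_angular_measure) auto
  note c = dunkl_const_pos[OF assms(1)]
  have "(\<integral>\<^sup>+y. \<integral>\<^sup>+\<theta>. \<Phi> (y * cos \<theta>, y * sin \<theta>) \<partial>angular_measure \<alpha> \<partial>dunkl_measure \<alpha>) =
     (\<integral>\<^sup>+y. ennreal (dunkl_density \<alpha> y) * (\<integral>\<^sup>+\<theta>. ennreal (indicator {0..pi} \<theta> * (dunkl_const \<alpha> * sin \<theta> powr (2 * \<alpha>))) *
        \<Phi> (y * cos \<theta>, y * sin \<theta>) \<partial>lborel) \<partial>lborel)"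
    using assms by (simp add: nn_integral_dunkl_measure nn_integral_angular)
  also have "\<dots> = (\<integral>\<^sup>+y. \<integral>\<^sup>+\<theta>. \<Phi> (y * cos \<theta>, y * sin \<theta>) * ?w (y * sin \<theta>) * ennreal \<bar>y\<bar> *
      indicator {0<..<pi} \<theta> \<partial>lborel \<partial>lborel)"
  proof (intro nn_integral_cong)
    fix y :: real
    have eq: "ennreal (dunkl_density \<alpha> y) * ennreal (indicator {0..pi} \<theta> * (dunkl_const \<alpha> * sin \<theta> powr (2 * \<alpha>))) =
       ?w (y * sin \<theta>) * ennreal \<bar>y\<bar> * indicator {0<..<pi} \<theta>" for \<theta>
    proof (cases "\<theta> \<in> {0<..<pi}")
      case True
      then have s: "0 < sin \<theta>" by (intro sin_gt_zero) auto
      have "dunkl_density \<alpha> y * (dunkl_const \<alpha> * sin \<theta> powr (2 * \<alpha>)) =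
          dunkl_const \<alpha> * dunkl_density \<alpha> 1 * \<bar>y * sin \<theta>\<bar> powr (2 * \<alpha>) * \<bar>y\<bar>"
        using s by (cases "y = 0") (auto simp: dunkl_density_def abs_mult powr_mult powr_add)
      then show ?thesis
        using True c assms by (auto simp: ennreal_mult[symmetric])
    next
      case False
      then show ?thesis by (cases "\<theta> = 0 \<or> \<theta> = pi") (auto simp: indicator_def)
    qed
    have "ennreal (dunkl_density \<alpha> y) * (\<integral>\<^sup>+\<theta>. ennreal (indicator {0..pi} \<theta> * (dunkl_const \<alpha> * sin \<theta> powr (2 * \<alpha>))) *
        \<Phi> (y * cos \<theta>, y * sin \<theta>) \<partial>lborel) =
      (\<integral>\<^sup>+\<theta>. ennreal (dunkl_density \<alpha> y) * (ennreal (indicator {0..pi} \<theta> * (dunkl_const \<alpha> * sin \<theta> powr (2 * \<alpha>))) *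
        \<Phi> (y * cos \<theta>, y * sin \<theta>)) \<partial>lborel)"
      by (subst nn_integral_cmult) auto
    also have "\<dots> = (\<integral>\<^sup>+\<theta>. \<Phi> (y * cos \<theta>, y * sin \<theta>) * ?w (y * sin \<theta>) * ennreal \<bar>y\<bar> *
      indicator {0<..<pi} \<theta> \<partial>lborel)"
    proof (rule nn_integral_cong)
      fix \<theta> :: real
      show "ennreal (dunkl_density \<alpha> y) * (ennreal (indicator {0..pi} \<theta> * (dunkl_const \<alpha> * sin \<theta> powr (2 * \<alpha>))) *
        \<Phi> (y * cos \<theta>, y * sin \<theta>)) = \<Phi> (y * cos \<theta>, y * sin \<theta>) * ?w (y * sin \<theta>) * ennreal \<bar>y\<bar> *
        indicator {0<..<pi} \<theta>" (is "?D * (?I * ?P) = ?P * ?W * ?Y * ?J")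
      proof -
        have "?D * (?I * ?P) = ?P * (?D * ?I)" by (simp only: mult_ac)
        then show ?thesis unfolding eq by (simp only: mult.assoc)
      qed
    qed
    finally show "ennreal (dunkl_density \<alpha> y) * (\<integral>\<^sup>+\<theta>. ennreal (indicator {0..pi} \<theta> * (dunkl_const \<alpha> * sin \<theta> powr (2 * \<alpha>))) *
        \<Phi> (y * cos \<theta>, y * sin \<theta>) \<partial>lborel) =
      (\<integral>\<^sup>+\<theta>. \<Phi> (y * cos \<theta>, y * sin \<theta>) * ?w (y * sin \<theta>) * ennreal \<bar>y\<bar> *
      indicator {0<..<pi} \<theta> \<partial>lborel)" .
  qed
  also have "\<dots> = (\<integral>\<^sup>+v. \<integral>\<^sup>+u. \<Phi> (u, v) * ?w v \<partial>lborel \<partial>lborel)"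
    using nn_integral_polar[of "\<lambda>(u, v). \<Phi> (u, v) * ?w v"] by simp
  finally show ?thesis .
qed

text \<open>The numbers \<open>\<bar>y\<bar>\<close> and \<open>dunkl_dist x y \<theta>\<close> are the distances from \<open>(u, v) = (y cos \<theta>, y sin \<theta>)\<close> to \<open>(0, 0)\<close>
  and \<open>(x, 0)\<close>. The reflection \<open>u \<mapsto> x - u\<close> swaps them and preserves the weight \<open>\<bar>v\<bar> powr (2\<alpha>)\<close>, which does not
  involve \<open>u\<close>. For \<open>\<alpha> = -1/2\<close> the reflection acts on the line.\<close>

lemma dunkl_exchange:
  fixes H :: "real \<times> real \<Rightarrow> ennreal"
  assumes \<alpha>: "-1/2 \<le> \<alpha>" and [measurable]: "H \<in> borel_measurable (borel \<Otimes>\<^sub>M borel)"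
  shows "(\<integral>\<^sup>+y. \<integral>\<^sup>+\<theta>. H (\<bar>y\<bar>, dunkl_dist x y \<theta>) \<partial>angular_measure \<alpha> \<partial>dunkl_measure \<alpha>) =
    (\<integral>\<^sup>+y. \<integral>\<^sup>+\<theta>. H (dunkl_dist x y \<theta>, \<bar>y\<bar>) \<partial>angular_measure \<alpha> \<partial>dunkl_measure \<alpha>)"
proof (cases "\<alpha> = - 1 / 2")
  case True
  have half: "(\<integral>\<^sup>+y. f y \<partial>dunkl_measure \<alpha>) = ennreal (dunkl_density \<alpha> 1) * (\<integral>\<^sup>+y. f y \<partial>lborel)"
    if [measurable]: "f \<in> borel_measurable borel" for f
  proof -
    have "AE y in lborel. y \<noteq> (0 :: real)" by (rule AE_lborel_singleton)
    then have "(\<integral>\<^sup>+y. ennreal (dunkl_density \<alpha> y) * f y \<partial>lborel) =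
        (\<integral>\<^sup>+y. ennreal (dunkl_density \<alpha> 1) * f y \<partial>lborel)"
    proof (intro nn_integral_cong_AE, eventually_elim)
      case (elim y)
      then show ?case by (simp add: dunkl_density_def True)
    qed
    then show ?thesis by (simp add: nn_integral_dunkl_measure nn_integral_cmult)
  qed
  have e1: "(\<integral>\<^sup>+y. H (\<bar>y\<bar>, \<bar>x + y\<bar>) \<partial>lborel) = (\<integral>\<^sup>+y. H (\<bar>y\<bar>, \<bar>x - y\<bar>) \<partial>lborel)"
    using nn_integral_real_affine[of "\<lambda>y. H (\<bar>y\<bar>, \<bar>x - y\<bar>)" "-1" 0] by simp
  have e2: "(\<integral>\<^sup>+y. H (\<bar>x - y\<bar>, \<bar>y\<bar>) \<partial>lborel) = (\<integral>\<^sup>+y. H (\<bar>y\<bar>, \<bar>x - y\<bar>) \<partial>lborel)"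
    using nn_integral_real_affine[of "\<lambda>y. H (\<bar>y\<bar>, \<bar>x - y\<bar>)" "-1" x] by simp
  have e3: "(\<integral>\<^sup>+y. H (\<bar>x + y\<bar>, \<bar>y\<bar>) \<partial>lborel) = (\<integral>\<^sup>+y. H (\<bar>y\<bar>, \<bar>x - y\<bar>) \<partial>lborel)"
    using nn_integral_real_affine[of "\<lambda>y. H (\<bar>y\<bar>, \<bar>x - y\<bar>)" 1 x] by simp
  show ?thesis
    by (simp add: nn_integral_angular_half[OF True] dunkl_dist_0 dunkl_dist_pi half nn_integral_cmult
        nn_integral_add e1 e2 e3)
next
  case False
  then have a: "-1/2 < \<alpha>" using \<alpha> by simp
  let ?w = "\<lambda>v. ennreal (dunkl_const \<alpha> * dunkl_density \<alpha> 1 * \<bar>v\<bar> powr (2 * \<alpha>))"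
  have abs: "\<bar>y\<bar> = sqrt ((y * cos \<theta>)\<^sup>2 + (y * sin \<theta>)\<^sup>2)" for y \<theta> :: real
  proof -
    have "(y * cos \<theta>)\<^sup>2 + (y * sin \<theta>)\<^sup>2 = y\<^sup>2 * ((sin \<theta>)\<^sup>2 + (cos \<theta>)\<^sup>2)"
      by (simp add: power_mult_distrib distrib_left del: sin_cos_squared_add)
    then show ?thesis by simp
  qed
  have "(\<integral>\<^sup>+y. \<integral>\<^sup>+\<theta>. H (\<bar>y\<bar>, dunkl_dist x y \<theta>) \<partial>angular_measure \<alpha> \<partial>dunkl_measure \<alpha>) =
      (\<integral>\<^sup>+v. \<integral>\<^sup>+u. H (sqrt (u\<^sup>2 + v\<^sup>2), sqrt ((x - u)\<^sup>2 + v\<^sup>2)) * ?w v \<partial>lborel \<partial>lborel)"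
    unfolding dunkl_dist_polar
    using nn_integral_dunkl_polar[OF a, of "\<lambda>(u, v). H (sqrt (u\<^sup>2 + v\<^sup>2), sqrt ((x - u)\<^sup>2 + v\<^sup>2))"]
    by (simp add: abs[symmetric])
  also have "\<dots> = (\<integral>\<^sup>+v. \<integral>\<^sup>+u. H (sqrt ((x - u)\<^sup>2 + v\<^sup>2), sqrt (u\<^sup>2 + v\<^sup>2)) * ?w v \<partial>lborel \<partial>lborel)"
  proof (rule nn_integral_cong)
    fix v :: real
    show "(\<integral>\<^sup>+u. H (sqrt (u\<^sup>2 + v\<^sup>2), sqrt ((x - u)\<^sup>2 + v\<^sup>2)) * ?w v \<partial>lborel) =
      (\<integral>\<^sup>+u. H (sqrt ((x - u)\<^sup>2 + v\<^sup>2), sqrt (u\<^sup>2 + v\<^sup>2)) * ?w v \<partial>lborel)"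
      using nn_integral_real_affine[of "\<lambda>u. H (sqrt (u\<^sup>2 + v\<^sup>2), sqrt ((x - u)\<^sup>2 + v\<^sup>2)) * ?w v" "-1" x]
      by simp
  qed
  also have "\<dots> = (\<integral>\<^sup>+y. \<integral>\<^sup>+\<theta>. H (dunkl_dist x y \<theta>, \<bar>y\<bar>) \<partial>angular_measure \<alpha> \<partial>dunkl_measure \<alpha>)"
    unfolding dunkl_dist_polar
    using nn_integral_dunkl_polar[OF a, of "\<lambda>(u, v). H (sqrt ((x - u)\<^sup>2 + v\<^sup>2), sqrt (u\<^sup>2 + v\<^sup>2))"]
    by (simp add: abs[symmetric])
  finally show ?thesis .
qed

lemma dunkl_dist_ge: "\<bar>\<bar>x\<bar> - \<bar>z\<bar>\<bar> \<le> dunkl_dist x z \<theta>"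
proof -
  have "x * z * cos \<theta> \<le> \<bar>x * z * cos \<theta>\<bar>" by simp
  also have "\<dots> \<le> \<bar>x\<bar> * \<bar>z\<bar> * 1" unfolding abs_mult by (intro mult_left_mono) auto
  finally have "(\<bar>x\<bar> - \<bar>z\<bar>)\<^sup>2 \<le> x\<^sup>2 + z\<^sup>2 - 2 * x * z * cos \<theta>"
    by (simp add: power2_diff)
  then have "sqrt ((\<bar>x\<bar> - \<bar>z\<bar>)\<^sup>2) \<le> dunkl_dist x z \<theta>"
    unfolding dunkl_dist_def by (rule real_sqrt_le_mono)
  then show ?thesis by simp
qed

text \<open>The points with polar coordinates \<open>(y, \<theta>)\<close> and \<open>(z, \<theta>)\<close> lie on one line through the origin, at distance
  \<open>\<bar>y - z\<bar>\<close>.\<close>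

lemma dunkl_dist_triangle: "dunkl_dist x y \<theta> \<le> dunkl_dist x z \<theta> + \<bar>y - z\<bar>"
proof -
  have norm: "dunkl_dist x y \<theta> = cmod (Complex (x - y * cos \<theta>) (y * sin \<theta>))" for y
    by (simp add: dunkl_dist_polar complex_norm)
  have "cmod (Complex (x - y * cos \<theta>) (y * sin \<theta>)) \<le> cmod (Complex (x - z * cos \<theta>) (z * sin \<theta>)) +
      cmod (Complex ((z - y) * cos \<theta>) ((y - z) * sin \<theta>))"
    by (rule order.trans[OF eq_refl norm_triangle_ineq], rule arg_cong[where f = cmod])
       (simp add: complex_eq_iff algebra_simps)
  also have "cmod (Complex ((z - y) * cos \<theta>) ((y - z) * sin \<theta>)) = \<bar>y - z\<bar>"
  proof -
    have "((z - y) * cos \<theta>)\<^sup>2 + ((y - z) * sin \<theta>)\<^sup>2 = (y - z)\<^sup>2 * ((sin \<theta>)\<^sup>2 + (cos \<theta>)\<^sup>2)"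
      by (simp add: power_mult_distrib distrib_left power2_commute[of z y] del: sin_cos_squared_add)
    then show ?thesis by (simp add: complex_norm)
  qed
  finally show ?thesis unfolding norm .
qed

text \<open>The quotient \<open>(x + y) / \<rho>\<close> is unbounded, but only for small \<open>\<theta>\<close>, where \<open>1 - cos \<theta>\<close> compensates: one has
  \<open>(x + y)\<^sup>2 = \<rho>\<^sup>2 + 2 x y (1 + cos \<theta>)\<close>, and \<open>2 x y sin\<^sup>2 \<theta> \<le> 2 \<rho>\<^sup>2\<close> because \<open>\<rho>\<close> is at least \<open>\<bar>x sin \<theta>\<bar>\<close> and
  \<open>\<bar>y sin \<theta>\<bar>\<close>.\<close>

lemma translation_kernel_bound: "\<bar>(x + y) / dunkl_dist x y \<theta> * (1 - cos \<theta>)\<bar> \<le> 3"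
proof (cases "dunkl_dist x y \<theta> = 0")
  case False
  then have \<rho>: "0 < dunkl_dist x y \<theta>" by (simp add: order_less_le)
  let ?c = "cos \<theta>" and ?s = "sin \<theta>"
  define R where "R = x\<^sup>2 + y\<^sup>2 - 2 * x * y * ?c"
  have s2: "?s\<^sup>2 = 1 - ?c\<^sup>2" by (rule sin_squared_eq)
  have "0 \<le> R"
    using \<rho> unfolding dunkl_dist_def R_def by simp
  have R_eq: "R = (dunkl_dist x y \<theta>)\<^sup>2"
    using \<open>0 \<le> R\<close> unfolding dunkl_dist_def R_def[symmetric] by simp
  have "R = (x - y * ?c)\<^sup>2 + y\<^sup>2 * ?s\<^sup>2"
    unfolding R_def s2 by (simp add: power2_eq_square algebra_simps)
  then have "y\<^sup>2 * ?s\<^sup>2 \<le> R" by simp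
  moreover have "R = (y - x * ?c)\<^sup>2 + x\<^sup>2 * ?s\<^sup>2"
    unfolding R_def s2 by (simp add: power2_eq_square algebra_simps)
  then have "x\<^sup>2 * ?s\<^sup>2 \<le> R" by simp
  moreover have "0 \<le> (x - y)\<^sup>2 * ?s\<^sup>2" by simp
  then have "2 * x * y * ?s\<^sup>2 \<le> x\<^sup>2 * ?s\<^sup>2 + y\<^sup>2 * ?s\<^sup>2"
    by (simp add: power2_eq_square algebra_simps)
  ultimately have xy: "2 * x * y * ?s\<^sup>2 \<le> 2 * R" by linarith
  have c: "0 \<le> 1 - ?c" "1 - ?c \<le> 2" using cos_ge_minus_one[of \<theta>] by simp_all
  have "((x + y) * (1 - ?c))\<^sup>2 = R * (1 - ?c)\<^sup>2 + 2 * x * y * ?s\<^sup>2 * (1 - ?c)"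
    unfolding R_def s2 by (simp add: power2_eq_square algebra_simps)
  also have "\<dots> \<le> R * 2\<^sup>2 + 2 * R * 2"
    using c xy \<open>0 \<le> R\<close>
    by (intro add_mono mult_left_mono power_mono order.trans[OF mult_right_mono[OF xy] mult_left_mono]) auto
  also have "\<dots> \<le> (3 * dunkl_dist x y \<theta>)\<^sup>2" using \<open>0 \<le> R\<close> by (simp add: power_mult_distrib R_eq)
  finally have "\<bar>(x + y) * (1 - ?c)\<bar> \<le> \<bar>3 * dunkl_dist x y \<theta>\<bar>"
    by (simp only: abs_le_square_iff)
  then show ?thesis using \<rho> by (simp add: abs_mult pos_divide_le_eq)
qed simp

text \<open>The quotient is the cosine of the angle at \<open>(x, 0)\<close> of the triangle with vertices \<open>(0, 0)\<close>, \<open>(x, 0)\<close> and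
  \<open>(y cos \<theta>, y sin \<theta>)\<close>.\<close>

lemma abs_cosine_le_1: "\<bar>(x - y * cos \<theta>) / dunkl_dist x y \<theta>\<bar> \<le> 1"
proof -
  have "\<bar>x - y * cos \<theta>\<bar> \<le> dunkl_dist x y \<theta>"
    unfolding dunkl_dist_polar by (rule real_le_rsqrt) simp
  then show ?thesis
    unfolding abs_divide abs_of_nonneg[OF dunkl_dist_nonneg]
    by (auto simp: divide_le_eq_1 order_less_le)
qed

section \<open>Ball weights and ball integrals\<close>

locale dunkl =
  fixes \<alpha> :: real
  assumes alpha: "-1/2 \<le> \<alpha>"
begin

abbreviation \<mu> :: "real measure" where "\<mu> \<equiv> dunkl_measure \<alpha>"
abbreviation \<sigma> :: "real measure" where "\<sigma> \<equiv> angular_measure \<alpha>"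
abbreviation d :: real where "d \<equiv> dunkl_dim \<alpha>"

text \<open>The interval \<open>(-r, r)\<close> has measure at most \<open>ball_const * r powr d\<close>.\<close>

definition ball_const :: real where "ball_const = 2 * dunkl_density \<alpha> 1"

sublocale mu: sigma_finite_measure \<mu>
  by (rule sigma_finite_dunkl_measure)

sublocale ang: sigma_finite_measure \<sigma>
  by (rule sigma_finite_angular_measure[OF alpha])

sublocale pair_sigma_finite \<mu> \<sigma> ..

sublocale mu_pair: pair_sigma_finite \<mu> \<mu> ..

lemma ball_const_pos: "0 < ball_const"
  using dunkl_density_pos[OF alpha, of 1] by (simp add: ball_const_def)

lemma d_pos: "0 < d"
  using alpha by (simp add: dunkl_dim_def)

text \<open>The Bessel translate (the positive even part of the Dunkl translation) of the indicator of \<open>(-r, r)\<close>.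
  For \<open>\<alpha> = -1/2\<close> it is, as a function of \<open>z\<close>, the mean of the indicators of \<open>(x - r, x + r)\<close> and
  \<open>(-x - r, -x + r)\<close>.\<close>

definition ball_weight :: "real \<Rightarrow> real \<Rightarrow> real \<Rightarrow> ennreal" where
  "ball_weight r x z = (\<integral>\<^sup>+\<theta>. indicator {..<r} (dunkl_dist x z \<theta>) \<partial>\<sigma>)"

definition ball_integral :: "real \<Rightarrow> (real \<Rightarrow> ennreal) \<Rightarrow> real \<Rightarrow> ennreal" where
  "ball_integral r g x = (\<integral>\<^sup>+z. g z * ball_weight r x z \<partial>\<mu>)"

lemma ball_weight_measurable [measurable (raw)]:
  assumes [measurable]: "x \<in> borel_measurable M" "z \<in> borel_measurable M"
  shows "(\<lambda>w. ball_weight r (x w) (z w)) \<in> borel_measurable M"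
  unfolding ball_weight_def by measurable

lemma ball_integral_measurable [measurable (raw)]:
  assumes [measurable]: "g \<in> borel_measurable borel" "x \<in> borel_measurable M"
  shows "(\<lambda>w. ball_integral r g (x w)) \<in> borel_measurable M"
  unfolding ball_integral_def by measurable

lemma ball_weight_commute: "ball_weight r x z = ball_weight r z x"
  by (simp add: ball_weight_def dunkl_dist_commute)

lemma ball_weight_uminus: "ball_weight r x (- z) = ball_weight r x z"
proof -
  have "ball_weight r x (- z) = (\<integral>\<^sup>+\<theta>. indicator {..<r} (dunkl_dist x z (pi - \<theta>)) \<partial>\<sigma>)"
    by (simp add: ball_weight_def dunkl_dist_reflect)
  also have "\<dots> = ball_weight r x z"
    unfolding ball_weight_def by (rule nn_integral_angular_reflect) measurable
  finally show ?thesis .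
qed

lemma ball_weight_uminus': "ball_weight r (- x) z = ball_weight r x z"
  using ball_weight_uminus ball_weight_commute by metis

lemma ball_weight_abs: "ball_weight r x \<bar>z\<bar> = ball_weight r x z"
  by (cases "0 \<le> z") (simp_all add: ball_weight_uminus)

lemma ball_integral_uminus: "ball_integral r g (- x) = ball_integral r g x"
  by (simp add: ball_integral_def ball_weight_uminus')

lemma ball_weight_eq_0: "r \<le> \<bar>\<bar>x\<bar> - \<bar>z\<bar>\<bar> \<Longrightarrow> ball_weight r x z = 0"
proof -
  assume "r \<le> \<bar>\<bar>x\<bar> - \<bar>z\<bar>\<bar>"
  then have "indicator {..<r} (dunkl_dist x z \<theta>) = (0 :: ennreal)" for \<theta>
    using dunkl_dist_ge[of x z \<theta>] by (auto simp: indicator_def)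
  then show ?thesis by (simp add: ball_weight_def)
qed

lemma ball_weight_le_1: "ball_weight r x z \<le> 1"
proof -
  have "ball_weight r x z \<le> (\<integral>\<^sup>+\<theta>. 1 \<partial>\<sigma>)"
    unfolding ball_weight_def by (intro nn_integral_mono) (auto simp: indicator_def)
  then show ?thesis using alpha by simp
qed

text \<open>The triangle inequality holds for each angle separately, so doubling the radius loses no constant.\<close>

lemma ball_weight_shift:
  assumes "\<bar>\<bar>z\<bar> - \<bar>y\<bar>\<bar> < r"
  shows "ball_weight r x z \<le> ball_weight (2 * r) x y"
proof -
  have "ball_weight r x \<bar>z\<bar> \<le> ball_weight (2 * r) x \<bar>y\<bar>"
    unfolding ball_weight_def
  proof (rule nn_integral_mono)
    fix \<theta>
    show "indicator {..<r} (dunkl_dist x \<bar>z\<bar> \<theta>) \<le> (indicator {..<2 * r} (dunkl_dist x \<bar>y\<bar> \<theta>) :: ennreal)"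
      using dunkl_dist_triangle[of x "\<bar>y\<bar>" \<theta> "\<bar>z\<bar>"] assms abs_minus_commute[of "\<bar>y\<bar>" "\<bar>z\<bar>"]
      by (auto simp: indicator_def)
  qed
  then show ?thesis by (simp add: ball_weight_abs)
qed

lemma ball_weight_zero: "ball_weight r 0 z = indicator {-r<..<r} z"
proof -
  have "indicator {..<r} (dunkl_dist 0 z \<theta>) = (indicator {-r<..<r} z :: ennreal)" for \<theta>
    by (auto simp: dunkl_dist_def indicator_def)
  then show ?thesis using alpha by (simp add: ball_weight_def)
qed

text \<open>By the exchange identity the mass equals \<open>\<mu> (-r, r)\<close>, whatever the centre \<open>x\<close>.\<close>

lemma nn_integral_ball_weight_le:
  assumes "0 < r"
  shows "(\<integral>\<^sup>+z. ball_weight r x z \<partial>\<mu>) \<le> ennreal (ball_const * r powr d)"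
proof -
  have "(\<integral>\<^sup>+z. ball_weight r x z \<partial>\<mu>) = (\<integral>\<^sup>+z. \<integral>\<^sup>+\<theta>. indicator {..<r} \<bar>z\<bar> \<partial>\<sigma> \<partial>\<mu>)"
    unfolding ball_weight_def using dunkl_exchange[OF alpha, of "\<lambda>(a, b). indicator {..<r} a" x] by simp
  also have "\<dots> = (\<integral>\<^sup>+z. indicator {-r<..<r} z \<partial>\<mu>)"
    using alpha by (intro nn_integral_cong) (auto simp: indicator_def)
  also have "\<dots> \<le> ennreal (ball_const * r powr d)"
    using emeasure_dunkl_ball_le[OF alpha assms] by (simp add: ball_const_def)
  finally show ?thesis .
qed

lemma ball_integral_mono: "(\<And>z. f z \<le> g z) \<Longrightarrow> ball_integral r f x \<le> ball_integral r g x"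
  unfolding ball_integral_def by (intro nn_integral_mono mult_right_mono) auto

lemma ball_integral_cmult:
  assumes [measurable]: "g \<in> borel_measurable borel"
  shows "ball_integral r (\<lambda>z. c * g z) x = c * ball_integral r g x"
  unfolding ball_integral_def by (simp add: mult.assoc nn_integral_cmult)

lemma ball_integral_const_le: "0 < r \<Longrightarrow> ball_integral r (\<lambda>_. c) x \<le> c * ennreal (ball_const * r powr d)"
  unfolding ball_integral_def using nn_integral_ball_weight_le[of r x] by (simp add: nn_integral_cmult mult_left_mono)

text \<open>Where the inner weight does not vanish, \<open>\<bar>y\<bar>\<close> and \<open>\<bar>z\<bar>\<close> differ by less than \<open>s \<le> r\<close>; there the outer weight
  at \<open>z\<close> is dominated by the one of radius \<open>2 r\<close> at \<open>y\<close>, and the inner weight can be integrated out.\<close>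

lemma ball_integral_comp_le:
  assumes "0 < s" "s \<le> r" and [measurable]: "g \<in> borel_measurable borel"
  shows "ball_integral r (ball_integral s g) x \<le> ennreal (ball_const * s powr d) * ball_integral (2 * r) g x"
proof -
  have "ball_integral r (ball_integral s g) x = (\<integral>\<^sup>+z. \<integral>\<^sup>+y. g y * (ball_weight r x z * ball_weight s y z) \<partial>\<mu> \<partial>\<mu>)"
    unfolding ball_integral_def
    by (intro nn_integral_cong, subst nn_integral_multc[symmetric])
       (auto intro!: nn_integral_cong simp: ball_weight_commute mult_ac)
  also have "\<dots> = (\<integral>\<^sup>+y. \<integral>\<^sup>+z. g y * (ball_weight r x z * ball_weight s y z) \<partial>\<mu> \<partial>\<mu>)"
    by (rule mu_pair.Fubini') measurable
  also have "\<dots> \<le> (\<integral>\<^sup>+y. ennreal (ball_const * s powr d) * (g y * ball_weight (2 * r) x y) \<partial>\<mu>)"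
  proof (rule nn_integral_mono)
    fix y
    have "(\<integral>\<^sup>+z. g y * (ball_weight r x z * ball_weight s y z) \<partial>\<mu>) \<le> (\<integral>\<^sup>+z. g y * ball_weight (2 * r) x y * ball_weight s y z \<partial>\<mu>)"
    proof (rule nn_integral_mono)
      fix z
      show "g y * (ball_weight r x z * ball_weight s y z) \<le> g y * ball_weight (2 * r) x y * ball_weight s y z"
      proof (cases "\<bar>\<bar>y\<bar> - \<bar>z\<bar>\<bar> < s")
        case True
        then have "ball_weight r x z \<le> ball_weight (2 * r) x y" using assms by (intro ball_weight_shift) auto
        then show ?thesis by (simp add: mult.assoc mult_left_mono mult_right_mono)
      next
        case False
        then show ?thesis using ball_weight_eq_0[of s y z] by simp
      qed
    qed
    also have "\<dots> = g y * ball_weight (2 * r) x y * (\<integral>\<^sup>+z. ball_weight s y z \<partial>\<mu>)"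
      by (rule nn_integral_cmult) measurable
    also have "\<dots> \<le> g y * ball_weight (2 * r) x y * ennreal (ball_const * s powr d)"
      using assms by (intro mult_left_mono nn_integral_ball_weight_le) auto
    finally show "(\<integral>\<^sup>+z. g y * (ball_weight r x z * ball_weight s y z) \<partial>\<mu>) \<le> ennreal (ball_const * s powr d) * (g y * ball_weight (2 * r) x y)"
      by (simp add: mult_ac)
  qed
  also have "\<dots> = ennreal (ball_const * s powr d) * ball_integral (2 * r) g x"
    unfolding ball_integral_def by (rule nn_integral_cmult) measurable
  finally show ?thesis .
qed

text \<open>The left side is what an integral of Dunkl translates over \<open>(-r, r)\<close> becomes after symmetrization. The
  exchange identity moves the restriction \<open>\<bar>y\<bar> < r\<close> to the distance and \<open>g\<close> to the free variable.\<close>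

lemma nn_integral_symmetrized:
  assumes [measurable]: "g \<in> borel_measurable borel"
  shows "(\<integral>\<^sup>+y. \<integral>\<^sup>+\<theta>. indicator {-r<..<r} y * (g (dunkl_dist x y \<theta>) + g (- dunkl_dist x y \<theta>)) \<partial>\<sigma> \<partial>\<mu>)
    = 2 * ball_integral r g x"
proof -
  have ind: "indicator {-r<..<r} y = (indicator {..<r} \<bar>y\<bar> :: ennreal)" for y :: real
    by (auto simp: indicator_def)
  have "(\<integral>\<^sup>+y. \<integral>\<^sup>+\<theta>. indicator {-r<..<r} y * (g (dunkl_dist x y \<theta>) + g (- dunkl_dist x y \<theta>)) \<partial>\<sigma> \<partial>\<mu>)
      = (\<integral>\<^sup>+z. \<integral>\<^sup>+\<theta>. indicator {..<r} (dunkl_dist x z \<theta>) * (g \<bar>z\<bar> + g (- \<bar>z\<bar>)) \<partial>\<sigma> \<partial>\<mu>)"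
    using dunkl_exchange[OF alpha, of "\<lambda>(a, b). indicator {..<r} a * (g b + g (- b))" x]
    by (simp add: ind)
  also have "\<dots> = (\<integral>\<^sup>+z. g z * ball_weight r x z + g (- z) * ball_weight r x (- z) \<partial>\<mu>)"
  proof (rule nn_integral_cong)
    fix z :: real
    have "(\<integral>\<^sup>+\<theta>. indicator {..<r} (dunkl_dist x z \<theta>) * (g \<bar>z\<bar> + g (- \<bar>z\<bar>)) \<partial>\<sigma>) = ball_weight r x z * (g \<bar>z\<bar> + g (- \<bar>z\<bar>))"
      unfolding ball_weight_def by (rule nn_integral_multc) measurable
    also have "\<dots> = ball_weight r x z * (g z + g (- z))"
      by (cases "0 \<le> z") (simp_all add: add.commute)
    also have "\<dots> = g z * ball_weight r x z + g (- z) * ball_weight r x (- z)"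
      unfolding ball_weight_uminus by (simp only: distrib_left mult.commute)
    finally show "(\<integral>\<^sup>+\<theta>. indicator {..<r} (dunkl_dist x z \<theta>) * (g \<bar>z\<bar> + g (- \<bar>z\<bar>)) \<partial>\<sigma>) =
        g z * ball_weight r x z + g (- z) * ball_weight r x (- z)" .
  qed
  also have "\<dots> = ball_integral r g x + (\<integral>\<^sup>+z. g (- z) * ball_weight r x (- z) \<partial>\<mu>)"
    unfolding ball_integral_def by (rule nn_integral_add) auto
  also have "(\<integral>\<^sup>+z. g (- z) * ball_weight r x (- z) \<partial>\<mu>) = ball_integral r g x"
    unfolding ball_integral_def by (rule nn_integral_dunkl_uminus) measurable
  finally show ?thesis by (simp add: mult_2)
qed

lemma ball_integral_le_ball:
  assumes [measurable]: "g \<in> borel_measurable borel"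
  shows "ball_integral r g x \<le> (\<integral>\<^sup>+z. g z * indicator {-(\<bar>x\<bar> + r)<..<\<bar>x\<bar> + r} z \<partial>\<mu>)"
  unfolding ball_integral_def
proof (rule nn_integral_mono)
  fix z
  show "g z * ball_weight r x z \<le> g z * indicator {-(\<bar>x\<bar> + r)<..<\<bar>x\<bar> + r} z"
  proof (cases "\<bar>\<bar>x\<bar> - \<bar>z\<bar>\<bar> < r")
    case True
    then show ?thesis using mult_left_mono[OF ball_weight_le_1[of r x z], of "g z"] by (auto simp: indicator_def)
  next
    case False
    then show ?thesis using ball_weight_eq_0[of r x z] by simp
  qed
qed

section \<open>Dunkl translates on symmetric intervals\<close>

definition trans_integrand :: "real \<Rightarrow> (real \<Rightarrow> real) \<Rightarrow> real \<Rightarrow> real \<Rightarrow> real" where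
  "trans_integrand x g y \<theta> =
     (g (dunkl_dist x y \<theta>) + g (- dunkl_dist x y \<theta>)
      + (x + y) / dunkl_dist x y \<theta> * (g (dunkl_dist x y \<theta>) - g (- dunkl_dist x y \<theta>))) * (1 - cos \<theta>)"

lemma trans_integrand_measurable [measurable (raw)]:
  assumes [measurable]: "g \<in> borel_measurable borel" "x \<in> borel_measurable M" "y \<in> borel_measurable M"
    "\<theta> \<in> borel_measurable M"
  shows "(\<lambda>w. trans_integrand (x w) g (y w) (\<theta> w)) \<in> borel_measurable M"
  unfolding trans_integrand_def by measurable

text \<open>For \<open>\<alpha> = -1/2\<close> the factor \<open>1 - cos \<theta>\<close> removes the atom at \<open>0\<close>, and the atom at \<open>\<pi>\<close> returns \<open>g (x + y)\<close>.\<close>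

lemma dunkl_translation_eq:
  assumes [measurable]: "g \<in> borel_measurable borel"
  shows "dunkl_translation \<alpha> x g y = (\<integral>\<theta>. trans_integrand x g y \<theta> \<partial>\<sigma>) / 2"
proof (cases "\<alpha> = - 1 / 2")
  case True
  have "(\<integral>\<theta>. trans_integrand x g y \<theta> \<partial>\<sigma>) = 2 * g (x + y)"
  proof -
    have "g \<bar>s\<bar> + g (- \<bar>s\<bar>) + s / \<bar>s\<bar> * (g \<bar>s\<bar> - g (- \<bar>s\<bar>)) = 2 * g s" for s
      by (cases s "0 :: real" rule: linorder_cases) simp_all
    from this[of "x + y"] show ?thesis
      by (subst integral_angular_half[OF True])
         (measurable, simp only: trans_integrand_def dunkl_dist_pi cos_zero cos_pi, simp)
  qed
  then show ?thesis using True by (simp add: dunkl_translation_def)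
next
  case False
  then have a: "-1/2 < \<alpha>" using alpha by simp
  have "(\<integral>\<theta>. trans_integrand x g y \<theta> \<partial>\<sigma>) =
      (\<integral>\<theta>. (indicator {0..pi} \<theta> * (dunkl_const \<alpha> * sin \<theta> powr (2 * \<alpha>))) *\<^sub>R trans_integrand x g y \<theta> \<partial>lborel)"
  proof -
    have "\<sigma> = density lborel (\<lambda>\<theta>. ennreal (indicator {0..pi} \<theta> * (dunkl_const \<alpha> * sin \<theta> powr (2 * \<alpha>))))"
      using False by (simp add: angular_measure_def)
    then show ?thesis
      using dunkl_const_pos[OF a] by (simp only:, intro integral_density) auto
  qed
  also have "\<dots> = (\<integral>\<theta>. dunkl_const \<alpha> * (indicator {0..pi} \<theta> *\<^sub>R (trans_integrand x g y \<theta> * sin \<theta> powr (2 * \<alpha>))) \<partial>lborel)"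
    by (intro Bochner_Integration.integral_cong) (auto simp: mult_ac)
  also have "\<dots> = dunkl_const \<alpha> * (LINT \<theta>:{0..pi}|lborel. trans_integrand x g y \<theta> * sin \<theta> powr (2 * \<alpha>))"
    by (simp add: set_lebesgue_integral_def)
  finally show ?thesis using False by (simp add: dunkl_translation_def trans_integrand_def)
qed

lemma trans_integrand_bound:
  assumes "\<And>z. 0 \<le> g z"
  shows "\<bar>trans_integrand x g y \<theta>\<bar> \<le> 5 * (g (dunkl_dist x y \<theta>) + g (- dunkl_dist x y \<theta>))"
proof -
  let ?a = "g (dunkl_dist x y \<theta>)" and ?b = "g (- dunkl_dist x y \<theta>)"
  have "trans_integrand x g y \<theta> = (1 - cos \<theta>) * (?a + ?b) + (x + y) / dunkl_dist x y \<theta> * (1 - cos \<theta>) * (?a - ?b)"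
  proof -
    define k where "k = (x + y) / dunkl_dist x y \<theta>"
    show ?thesis unfolding trans_integrand_def k_def[symmetric] by (simp add: algebra_simps)
  qed
  also have "\<bar>\<dots>\<bar> \<le> \<bar>1 - cos \<theta>\<bar> * \<bar>?a + ?b\<bar> + \<bar>(x + y) / dunkl_dist x y \<theta> * (1 - cos \<theta>)\<bar> * \<bar>?a - ?b\<bar>"
    by (rule order.trans[OF abs_triangle_ineq]) (simp only: abs_mult)
  also have "\<dots> \<le> 2 * (?a + ?b) + 3 * (?a + ?b)"
    using assms[of "dunkl_dist x y \<theta>"] assms[of "- dunkl_dist x y \<theta>"] cos_ge_minus_one[of \<theta>] cos_le_one[of \<theta>]
    by (intro add_mono mult_mono translation_kernel_bound) (auto simp: abs_le_iff)
  finally show ?thesis by simp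
qed

lemma distr_reflect: "distr (\<mu> \<Otimes>\<^sub>M \<sigma>) (borel \<Otimes>\<^sub>M borel) (\<lambda>(y, \<theta>). (- y, pi - \<theta>)) = \<mu> \<Otimes>\<^sub>M \<sigma>"
proof -
  have "distr \<mu> borel uminus \<Otimes>\<^sub>M distr \<sigma> borel (\<lambda>\<theta>. pi - \<theta>) =
      distr (\<mu> \<Otimes>\<^sub>M \<sigma>) (borel \<Otimes>\<^sub>M borel) (\<lambda>(y, \<theta>). (- y, pi - \<theta>))"
    by (rule pair_measure_distr)
       (measurable, unfold distr_angular_measure_reflect, rule ang.sigma_finite_measure_axioms)
  then show ?thesis unfolding distr_dunkl_measure_uminus distr_angular_measure_reflect by (rule sym)
qed

lemma distr_uminus_fst: "distr (\<mu> \<Otimes>\<^sub>M \<sigma>) (borel \<Otimes>\<^sub>M borel) (\<lambda>(y, \<theta>). (- y, \<theta>)) = \<mu> \<Otimes>\<^sub>M \<sigma>"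
proof -
  have id: "distr \<sigma> borel (\<lambda>\<theta>. \<theta>) = \<sigma>" by (rule distr_id2) simp
  have "distr \<mu> borel uminus \<Otimes>\<^sub>M distr \<sigma> borel (\<lambda>\<theta>. \<theta>) =
      distr (\<mu> \<Otimes>\<^sub>M \<sigma>) (borel \<Otimes>\<^sub>M borel) (\<lambda>(y, \<theta>). (- y, \<theta>))"
    by (rule pair_measure_distr) (measurable, unfold id, rule ang.sigma_finite_measure_axioms)
  then show ?thesis unfolding distr_dunkl_measure_uminus id by (rule sym)
qed

text \<open>The sum of half the translation integrand over an orbit of the involution \<open>(y, \<theta>) \<mapsto> (-y, \<pi> - \<theta>)\<close>. The
  involution keeps the distance \<open>\<rho>\<close>; the factors \<open>(x + y) (1 - cos \<theta>)\<close> and \<open>(x - y) (1 + cos \<theta>)\<close> add up to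
  \<open>2 (x - y cos \<theta>)\<close>, and \<open>(x - y cos \<theta>) / \<rho>\<close> is a cosine, which makes the sum nonnegative for \<open>g \<ge> 0\<close>.\<close>

definition sym_integrand :: "real \<Rightarrow> real \<Rightarrow> (real \<Rightarrow> real) \<Rightarrow> real \<times> real \<Rightarrow> real" where
  "sym_integrand r x g = (\<lambda>(y, \<theta>). indicator {-r<..<r} y *
     (g (dunkl_dist x y \<theta>) * (1 + (x - y * cos \<theta>) / dunkl_dist x y \<theta>) +
      g (- dunkl_dist x y \<theta>) * (1 - (x - y * cos \<theta>) / dunkl_dist x y \<theta>)))"

lemma sym_integrand_nonneg:
  assumes "\<And>z. 0 \<le> g z"
  shows "0 \<le> sym_integrand r x g w"
proof (cases w)
  case (Pair y \<theta>)
  define k where "k = (x - y * cos \<theta>) / dunkl_dist x y \<theta>"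
  have "\<bar>k\<bar> \<le> 1" unfolding k_def by (rule abs_cosine_le_1)
  then have "0 \<le> 1 + k" "0 \<le> 1 - k" by (simp_all add: abs_le_iff)
  then have "0 \<le> a * (1 + k) + b * (1 - k)" if "0 \<le> a" "0 \<le> b" for a b :: real
    using that by (intro add_nonneg_nonneg[of "a * (1 + k)"] mult_nonneg_nonneg) auto
  then show ?thesis
    unfolding Pair sym_integrand_def prod.case k_def[symmetric]
    using assms by (intro mult_nonneg_nonneg) auto
qed

lemma sym_integrand_uminus:
  "sym_integrand r x g (y, \<theta>) + sym_integrand r (- x) g (- y, \<theta>) =
    2 * (indicator {-r<..<r} y * (g (dunkl_dist x y \<theta>) + g (- dunkl_dist x y \<theta>)))"
proof -
  have ind: "indicator {-r<..<r} (- y) = (indicator {-r<..<r} y :: real)" by (auto simp: indicator_def)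
  have k: "(- x - - y * cos \<theta>) / dunkl_dist x y \<theta> = - ((x - y * cos \<theta>) / dunkl_dist x y \<theta>)"
    by (simp add: minus_divide_left)
  have alg: "i * (a * (1 + k) + b * (1 - k)) + i * (a * (1 + - k) + b * (1 - - k)) = 2 * (i * (a + b))"
    for i a b k :: real
    by (simp add: algebra_simps)
  show ?thesis
    unfolding sym_integrand_def prod.case dunkl_dist_reflect(2) minus_minus ind k by (rule alg)
qed

lemma symmetrized_integral:
  assumes [measurable]: "g \<in> borel_measurable borel" and "\<And>z. 0 \<le> g z"
    and fin: "ball_integral r (\<lambda>z. ennreal (g z)) x < \<infinity>"
  shows "integrable (\<mu> \<Otimes>\<^sub>M \<sigma>) (\<lambda>(y, \<theta>). indicator {-r<..<r} y * (g (dunkl_dist x y \<theta>) + g (- dunkl_dist x y \<theta>)))"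
    and "ennreal (\<integral>(y, \<theta>). indicator {-r<..<r} y * (g (dunkl_dist x y \<theta>) + g (- dunkl_dist x y \<theta>)) \<partial>(\<mu> \<Otimes>\<^sub>M \<sigma>))
      = 2 * ball_integral r (\<lambda>z. ennreal (g z)) x"
proof -
  let ?f = "\<lambda>(y, \<theta>). indicator {-r<..<r} y * (g (dunkl_dist x y \<theta>) + g (- dunkl_dist x y \<theta>))"
  have nn: "0 \<le> ?f w" for w using assms by (cases w) auto
  have [measurable]: "?f \<in> borel_measurable (\<mu> \<Otimes>\<^sub>M \<sigma>)" by measurable
  have "(\<integral>\<^sup>+w. ennreal (?f w) \<partial>(\<mu> \<Otimes>\<^sub>M \<sigma>)) = (\<integral>\<^sup>+y. \<integral>\<^sup>+\<theta>. ennreal (?f (y, \<theta>)) \<partial>\<sigma> \<partial>\<mu>)"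
    by (rule ang.nn_integral_fst[symmetric]) measurable
  also have "\<dots> = (\<integral>\<^sup>+y. \<integral>\<^sup>+\<theta>. indicator {-r<..<r} y * (ennreal (g (dunkl_dist x y \<theta>)) + ennreal (g (- dunkl_dist x y \<theta>))) \<partial>\<sigma> \<partial>\<mu>)"
    using assms by (intro nn_integral_cong) (auto simp: indicator_def)
  also have "\<dots> = 2 * ball_integral r (\<lambda>z. ennreal (g z)) x"
    by (rule nn_integral_symmetrized) measurable
  finally have eq: "(\<integral>\<^sup>+w. ennreal (?f w) \<partial>(\<mu> \<Otimes>\<^sub>M \<sigma>)) = 2 * ball_integral r (\<lambda>z. ennreal (g z)) x" .
  have "(\<integral>\<^sup>+w. ennreal (norm (?f w)) \<partial>(\<mu> \<Otimes>\<^sub>M \<sigma>)) < \<infinity>"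
    using nn eq fin by (simp add: ennreal_mult_less_top)
  then show int: "integrable (\<mu> \<Otimes>\<^sub>M \<sigma>) ?f" by (intro integrableI_bounded) auto
  show "ennreal (integral\<^sup>L (\<mu> \<Otimes>\<^sub>M \<sigma>) ?f) = 2 * ball_integral r (\<lambda>z. ennreal (g z)) x"
    using nn_integral_eq_integral[OF int] nn eq by simp
qed

text \<open>Finiteness of the ball integral makes the translation integrand absolutely integrable over
  \<open>(-r, r) \<times> [0, \<pi>]\<close>, so that Fubini's theorem applies and the invariance of \<open>\<mu> \<Otimes> \<sigma>\<close> under the involution
  symmetrizes it.\<close>

lemma integral_translation:
  assumes [measurable]: "g \<in> borel_measurable borel" and nn: "\<And>z. 0 \<le> g z"
    and fin: "ball_integral r (\<lambda>z. ennreal (g z)) x < \<infinity>"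
  shows "integrable (\<mu> \<Otimes>\<^sub>M \<sigma>) (sym_integrand r x g)"
    and "(LINT y:{-r<..<r}|\<mu>. dunkl_translation \<alpha> x g y) = (\<integral>w. sym_integrand r x g w \<partial>(\<mu> \<Otimes>\<^sub>M \<sigma>)) / 2"
proof -
  let ?P = "\<mu> \<Otimes>\<^sub>M \<sigma>"
  let ?T = "\<lambda>(y, \<theta>). (- y, pi - \<theta>) :: real \<times> real"
  define \<Gamma> where "\<Gamma> = (\<lambda>(y, \<theta>). indicator {-r<..<r} y * (trans_integrand x g y \<theta> / 2))"
  let ?f = "\<lambda>(y, \<theta>). indicator {-r<..<r} y * (g (dunkl_dist x y \<theta>) + g (- dunkl_dist x y \<theta>))"
  have \<Gamma>ball_const [measurable]: "\<Gamma> \<in> borel_measurable (borel \<Otimes>\<^sub>M borel)" unfolding \<Gamma>_def by measurable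
  have Tm [measurable]: "?T \<in> (borel \<Otimes>\<^sub>M borel) \<rightarrow>\<^sub>M (borel \<Otimes>\<^sub>M borel)" by measurable
  have int: "integrable ?P \<Gamma>"
  proof (rule Bochner_Integration.integrable_bound)
    show "integrable ?P (\<lambda>w. 5 / 2 * ?f w)"
      using symmetrized_integral(1)[OF assms] by (intro integrable_mult_right)
    show "AE w in ?P. norm (\<Gamma> w) \<le> norm (5 / 2 * ?f w)"
    proof (rule AE_I2)
      fix w :: "real \<times> real"
      show "norm (\<Gamma> w) \<le> norm (5 / 2 * ?f w)"
        using trans_integrand_bound[where g = g and x = x and y = "fst w" and \<theta> = "snd w", OF nn] nn
        by (cases w) (auto simp: \<Gamma>_def indicator_def)
    qed
  qed measurable
  have intT: "integrable ?P (\<lambda>w. \<Gamma> (?T w))"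
    using int by (subst (asm) distr_reflect[symmetric]) (auto simp: integrable_distr_eq)
  have sum: "sym_integrand r x g w = \<Gamma> w + \<Gamma> (?T w)" for w
  proof (cases w)
    case (Pair y \<theta>)
    have ind: "indicator {-r<..<r} (- y) = (indicator {-r<..<r} y :: real)" by (auto simp: indicator_def)
    have \<rho>: "dunkl_dist x (- y) (pi - \<theta>) = dunkl_dist x y \<theta>" by (simp add: dunkl_dist_reflect)
    have alg: "i * (a * (1 + (x - y * c) * s) + b * (1 - (x - y * c) * s)) =
        i * ((a + b + (x + y) * s * (a - b)) * (1 - c) / 2) +
        i * ((a + b + (x + - y) * s * (a - b)) * (1 - - c) / 2)" for i a b c s :: real
      by (simp add: field_simps)
    have cos: "cos (pi - \<theta>) = - cos \<theta>" by simp
    show ?thesis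
      unfolding Pair \<Gamma>_def sym_integrand_def trans_integrand_def prod.case ind \<rho> cos
      using alg[where s = "inverse (dunkl_dist x y \<theta>)", folded divide_inverse] by this
  qed
  show "integrable ?P (sym_integrand r x g)"
    unfolding sum[abs_def] using int intT by (rule Bochner_Integration.integrable_add)
  have "(LINT y:{-r<..<r}|\<mu>. dunkl_translation \<alpha> x g y) = (\<integral>y. \<integral>\<theta>. \<Gamma> (y, \<theta>) \<partial>\<sigma> \<partial>\<mu>)"
    unfolding set_lebesgue_integral_def
    by (intro Bochner_Integration.integral_cong) (auto simp: dunkl_translation_eq \<Gamma>_def)
  also have "\<dots> = integral\<^sup>L ?P \<Gamma>"
    by (rule integral_fst'[OF int])
  finally have J: "(LINT y:{-r<..<r}|\<mu>. dunkl_translation \<alpha> x g y) = integral\<^sup>L ?P \<Gamma>" .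
  have "integral\<^sup>L ?P \<Gamma> = (\<integral>w. \<Gamma> (?T w) \<partial>?P)"
    by (subst distr_reflect[symmetric]) (auto simp: integral_distr)
  then have "(\<integral>w. sym_integrand r x g w \<partial>?P) = 2 * integral\<^sup>L ?P \<Gamma>"
    unfolding sum[abs_def] using int intT by (simp add: Bochner_Integration.integral_add)
  then show "(LINT y:{-r<..<r}|\<mu>. dunkl_translation \<alpha> x g y) = (\<integral>w. sym_integrand r x g w \<partial>?P) / 2"
    using J by simp
qed

lemma integral_translation_nonneg:
  assumes [measurable]: "g \<in> borel_measurable borel" and nn: "\<And>z. 0 \<le> g z"
    and fin: "ball_integral r (\<lambda>z. ennreal (g z)) x < \<infinity>"
  shows "0 \<le> (LINT y:{-r<..<r}|\<mu>. dunkl_translation \<alpha> x g y)"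
  unfolding integral_translation(2)[OF assms]
  by (intro divide_nonneg_pos Bochner_Integration.integral_nonneg sym_integrand_nonneg nn zero_less_numeral)

text \<open>Changing the signs of \<open>x\<close> and \<open>y\<close> keeps the distance and reverses the sign of the cosine, so that the
  cosine terms cancel in the sum.\<close>

lemma integral_translation_add:
  assumes [measurable]: "g \<in> borel_measurable borel" and nn: "\<And>z. 0 \<le> g z"
    and fin: "ball_integral r (\<lambda>z. ennreal (g z)) x < \<infinity>"
  shows "ennreal ((LINT y:{-r<..<r}|\<mu>. dunkl_translation \<alpha> x g y) +
    (LINT y:{-r<..<r}|\<mu>. dunkl_translation \<alpha> (- x) g y)) = 2 * ball_integral r (\<lambda>z. ennreal (g z)) x"
proof -
  let ?P = "\<mu> \<Otimes>\<^sub>M \<sigma>"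
  let ?S = "\<lambda>(y, \<theta>). (- y, \<theta>) :: real \<times> real"
  have fin': "ball_integral r (\<lambda>z. ennreal (g z)) (- x) < \<infinity>" using fin by (simp add: ball_integral_uminus)
  note i = integral_translation(1)[OF assms] integral_translation(1)[OF assms(1,2) fin']
  have [measurable]: "sym_integrand r (- x) g \<in> borel_measurable (borel \<Otimes>\<^sub>M borel)"
    unfolding sym_integrand_def by measurable
  have [measurable]: "?S \<in> (borel \<Otimes>\<^sub>M borel) \<rightarrow>\<^sub>M (borel \<Otimes>\<^sub>M borel)" by measurable
  have iS: "integrable ?P (\<lambda>w. sym_integrand r (- x) g (?S w))"
    using i(2) by (subst (asm) distr_uminus_fst[symmetric]) (auto simp: integrable_distr_eq)
  have "(\<integral>w. sym_integrand r (- x) g w \<partial>?P) = (\<integral>w. sym_integrand r (- x) g (?S w) \<partial>?P)"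
    by (subst distr_uminus_fst[symmetric]) (auto simp: integral_distr)
  then have "(\<integral>w. sym_integrand r x g w \<partial>?P) + (\<integral>w. sym_integrand r (- x) g w \<partial>?P) =
      (\<integral>w. sym_integrand r x g w + sym_integrand r (- x) g (?S w) \<partial>?P)"
    using i(1) iS by simp
  also have "\<dots> = (\<integral>w. 2 * (case w of (y, \<theta>) \<Rightarrow> indicator {-r<..<r} y * (g (dunkl_dist x y \<theta>) + g (- dunkl_dist x y \<theta>))) \<partial>?P)"
  proof (rule Bochner_Integration.integral_cong[OF refl])
    fix w :: "real \<times> real"
    show "sym_integrand r x g w + sym_integrand r (- x) g (?S w) = 2 * (case w of (y, \<theta>) \<Rightarrow> indicator {-r<..<r} y * (g (dunkl_dist x y \<theta>) + g (- dunkl_dist x y \<theta>)))"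
      by (cases w) (simp only: prod.case sym_integrand_uminus)
  qed
  also have "\<dots> = 2 * (\<integral>(y, \<theta>). indicator {-r<..<r} y * (g (dunkl_dist x y \<theta>) + g (- dunkl_dist x y \<theta>)) \<partial>?P)"
    by (rule integral_mult_right_zero)
  finally have eq: "(\<integral>w. sym_integrand r x g w \<partial>?P) / 2 + (\<integral>w. sym_integrand r (- x) g w \<partial>?P) / 2 =
      (\<integral>(y, \<theta>). indicator {-r<..<r} y * (g (dunkl_dist x y \<theta>) + g (- dunkl_dist x y \<theta>)) \<partial>?P)"
    by linarith
  show ?thesis
    unfolding integral_translation(2)[OF assms] integral_translation(2)[OF assms(1,2) fin'] eq
    by (rule symmetrized_integral(2)[OF assms])
qed

end

section \<open>Ball integrals of a function with a Morrey bound\<close>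

text \<open>Young's inequality \<open>h \<le> B powr (1 - p) * h powr p / p + (1 - 1/p) * B\<close> is integrated against \<open>w\<close>. The bound is
  expressed by a real number \<open>B\<close>, so that no power of an infinite integral has to be formed.\<close>

lemma nn_integral_jensen:
  fixes h :: "'a \<Rightarrow> real" and w :: "'a \<Rightarrow> ennreal"
  assumes [measurable]: "h \<in> borel_measurable M" "w \<in> borel_measurable M"
    and h: "\<And>z. 0 \<le> h z" and p: "1 \<le> p" and c: "0 \<le> c" and B: "0 \<le> B"
    and mass: "(\<integral>\<^sup>+z. w z \<partial>M) \<le> ennreal c"
    and power: "(\<integral>\<^sup>+z. ennreal (h z powr p) * w z \<partial>M) \<le> ennreal (c * B powr p)"
  shows "(\<integral>\<^sup>+z. ennreal (h z) * w z \<partial>M) \<le> ennreal (c * B)"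
proof (cases "B = 0")
  case True
  then have "(\<integral>\<^sup>+z. ennreal (h z powr p) * w z \<partial>M) = 0" using power p by simp
  then have "AE z in M. ennreal (h z powr p) * w z = 0"
    by (subst (asm) nn_integral_0_iff_AE) auto
  then have "AE z in M. ennreal (h z) * w z = 0"
    by eventually_elim (use h in \<open>auto simp: powr_eq_0_iff\<close>)
  then have "(\<integral>\<^sup>+z. ennreal (h z) * w z \<partial>M) = 0"
    by (subst nn_integral_0_iff_AE) auto
  then show ?thesis by simp
next
  case False
  then have B: "0 < B" using B by simp
  \<comment> \<open>Here \<open>x \<le> x powr p / p + (1 - 1/p)\<close> is scaled by \<open>B\<close>, with \<open>x = h z / B\<close>.\<close>
  have young: "h z \<le> B powr (1 - p) / p * h z powr p + (1 - 1 / p) * B" for z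
  proof (cases "h z = 0")
    case False
    then have hz: "0 < h z" using h[of z] by simp
    have "((h z / B) powr p) powr (1 / p) * 1 powr (1 - 1 / p) \<le> 1 / p * (h z / B) powr p + (1 - 1 / p) * 1"
      using hz B p by (intro Youngs_inequality_0) auto
    then have "h z / B \<le> 1 / p * (h z / B) powr p + (1 - 1 / p)"
      using hz B p by (simp add: powr_powr)
    then have "h z / B * B \<le> (1 / p * (h z / B) powr p + (1 - 1 / p)) * B"
      using B by (intro mult_right_mono) auto
    also have "\<dots> = B powr (1 - p) / p * h z powr p + (1 - 1 / p) * B"
      using B by (simp add: powr_divide powr_diff distrib_left mult_ac)
    finally show ?thesis using B by simp
  qed (use p B in simp)
  define k where "k = B powr (1 - p) / p"
  define l where "l = (1 - 1 / p) * B"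
  have kl: "0 \<le> k" "0 \<le> l" using p B by (auto simp: k_def l_def)
  have "(\<integral>\<^sup>+z. ennreal (h z) * w z \<partial>M) \<le>
      (\<integral>\<^sup>+z. ennreal k * (ennreal (h z powr p) * w z) + ennreal l * w z \<partial>M)"
  proof (rule nn_integral_mono)
    fix z
    have "ennreal (h z) \<le> ennreal (k * h z powr p + l)"
      unfolding k_def l_def by (rule ennreal_leI[OF young])
    also have "\<dots> = ennreal k * ennreal (h z powr p) + ennreal l"
      using kl by (simp add: ennreal_mult)
    finally have "ennreal (h z) \<le> ennreal k * ennreal (h z powr p) + ennreal l" .
    then have "ennreal (h z) * w z \<le> (ennreal k * ennreal (h z powr p) + ennreal l) * w z"
      by (rule mult_right_mono) simp
    then show "ennreal (h z) * w z \<le> ennreal k * (ennreal (h z powr p) * w z) + ennreal l * w z"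
      by (simp add: distrib_right mult.assoc)
  qed
  also have "\<dots> = ennreal k * (\<integral>\<^sup>+z. ennreal (h z powr p) * w z \<partial>M) + ennreal l * (\<integral>\<^sup>+z. w z \<partial>M)"
    by (subst nn_integral_add) (auto simp: nn_integral_cmult)
  also have "\<dots> \<le> ennreal k * ennreal (c * B powr p) + ennreal l * ennreal c"
    using mass power by (intro add_mono mult_left_mono) auto
  also have "\<dots> = ennreal (k * (c * B powr p) + l * c)"
    using kl c by (simp add: ennreal_mult[symmetric] ennreal_plus[symmetric] del: ennreal_plus)
  also have "k * (c * B powr p) + l * c = c * B"
    using B p by (simp add: k_def l_def powr_diff field_simps)
  finally show ?thesis .
qed

text \<open>In the application \<open>a\<close> is the absolute value of a function and \<open>N\<close> its Morrey norm. The last assumption is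
  the Morrey bound in terms of ball integrals.\<close>

locale morrey_function = dunkl +
  fixes a \<phi> :: "real \<Rightarrow> real" and p N C\<phi> :: real
  assumes a_measurable [measurable]: "a \<in> borel_measurable borel" and a_nonneg: "\<And>z. 0 \<le> a z"
    and p: "1 \<le> p" and N: "0 \<le> N" and C\<phi>: "1 \<le> C\<phi>"
    and \<phi>_pos: "\<And>r. 0 < r \<Longrightarrow> 0 < \<phi> r"
    and \<phi>_dec: "\<And>r s. 0 < r \<Longrightarrow> r \<le> s \<Longrightarrow> \<phi> s \<le> C\<phi> * \<phi> r"
    and ball_integral_power_le: "\<And>r x. 0 < r \<Longrightarrow> ball_integral r (\<lambda>z. ennreal (a z powr p)) x \<le> ennreal (r powr d * (\<phi> r * N) powr p)"
begin

lemma ball_integral_bound: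
  assumes "0 < s"
  shows "ball_integral s (\<lambda>z. ennreal (a z)) x \<le> ennreal (ball_const powr (1 - 1 / p) * s powr d * \<phi> s * N)"
proof -
  have "ball_integral s (\<lambda>z. ennreal (a z)) x \<le> ennreal (ball_const * s powr d * (ball_const powr (- 1 / p) * (\<phi> s * N)))"
    unfolding ball_integral_def
  proof (rule nn_integral_jensen[OF _ _ a_nonneg p])
    show "(\<integral>\<^sup>+z. ball_weight s x z \<partial>\<mu>) \<le> ennreal (ball_const * s powr d)" using assms by (rule nn_integral_ball_weight_le)
    have "ball_const * s powr d * (ball_const powr (- 1 / p) * (\<phi> s * N)) powr p = s powr d * (\<phi> s * N) powr p"
      using ball_const_pos p by (simp add: powr_mult powr_divide powr_powr powr_minus_divide)
    then show "(\<integral>\<^sup>+z. ennreal (a z powr p) * ball_weight s x z \<partial>\<mu>) \<le> ennreal (ball_const * s powr d * (ball_const powr (- 1 / p) * (\<phi> s * N)) powr p)"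
      using ball_integral_power_le[OF assms, of x] by (simp only: ball_integral_def)
  qed (use ball_const_pos \<phi>_pos[OF assms] N in auto)
  also have "ball_const * s powr d * (ball_const powr (- 1 / p) * (\<phi> s * N)) = ball_const powr (1 - 1 / p) * s powr d * \<phi> s * N"
    using ball_const_pos by (simp add: powr_diff powr_minus_divide)
  finally show ?thesis .
qed

text \<open>The ball integral of \<open>a\<close> as a real number; no information is lost, since it is finite by the bound above.\<close>

definition ball_sum :: "real \<Rightarrow> real \<Rightarrow> real" where
  "ball_sum s z = enn2real (ball_integral s (\<lambda>z. ennreal (a z)) z)"

lemma ball_sum_measurable [measurable]: "ball_sum s \<in> borel_measurable borel"
  unfolding ball_sum_def by measurable

lemma ball_sum_nonneg: "0 \<le> ball_sum s z"
  by (simp add: ball_sum_def)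

lemma ball_integral_eq_ball_sum: "0 < s \<Longrightarrow> ball_integral s (\<lambda>z. ennreal (a z)) z = ennreal (ball_sum s z)"
  using ball_integral_bound[of s z] by (auto simp: ball_sum_def ennreal_enn2real_if top_unique)

lemma ball_sum_bound: "0 < s \<Longrightarrow> ball_sum s z \<le> ball_const powr (1 - 1 / p) * s powr d * \<phi> s * N"
  using ball_integral_bound[of s z] \<phi>_pos[of s] N by (simp add: ball_integral_eq_ball_sum ennreal_le_iff)

lemma ball_sum_power_le:
  assumes "0 < s"
  shows "ennreal (ball_sum s z powr p) \<le> ennreal ((ball_const * s powr d) powr (p - 1)) * ball_integral s (\<lambda>z. ennreal (a z powr p)) z"
proof -
  define c where "c = ball_const * s powr d"
  have c: "0 < c" using ball_const_pos assms by (simp add: c_def)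
  obtain I where I: "0 \<le> I" "ball_integral s (\<lambda>z. ennreal (a z powr p)) z = ennreal I"
    using ball_integral_power_le[OF assms, of z] by (cases "ball_integral s (\<lambda>z. ennreal (a z powr p)) z") (auto simp: top_unique)
  have "ball_integral s (\<lambda>z. ennreal (a z)) z \<le> ennreal (c * (I / c) powr (1 / p))"
    unfolding ball_integral_def
  proof (rule nn_integral_jensen[OF _ _ a_nonneg p])
    show "(\<integral>\<^sup>+y. ball_weight s z y \<partial>\<mu>) \<le> ennreal c" unfolding c_def using assms by (rule nn_integral_ball_weight_le)
    show "(\<integral>\<^sup>+y. ennreal (a y powr p) * ball_weight s z y \<partial>\<mu>) \<le> ennreal (c * ((I / c) powr (1 / p)) powr p)"
      using I c p by (simp add: ball_integral_def powr_powr)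
  qed (use c I in auto)
  then have "ball_sum s z \<le> c * (I / c) powr (1 / p)"
    using assms c by (simp add: ball_integral_eq_ball_sum ennreal_le_iff)
  then have "ball_sum s z powr p \<le> (c * (I / c) powr (1 / p)) powr p"
    using p ball_sum_nonneg by (intro powr_mono2) auto
  also have "\<dots> = c powr (p - 1) * I"
    using c I p by (simp add: powr_mult powr_powr powr_diff)
  finally show ?thesis
    using I by (simp add: c_def ennreal_mult[symmetric])
qed

lemma \<phi>_N_power_le:
  assumes "0 < r" "r \<le> s"
  shows "(\<phi> s * N) powr p \<le> C\<phi> powr p * (\<phi> r * N) powr p"
proof -
  have "(\<phi> s * N) powr p \<le> (C\<phi> * \<phi> r * N) powr p"
    using assms \<phi>_dec[OF assms] \<phi>_pos[of s] N p by (intro powr_mono2 mult_right_mono) auto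
  then show ?thesis by (simp add: powr_mult mult.assoc)
qed

text \<open>The operators that average over balls of radius \<open>s\<close> preserve the Morrey bound up to a constant that does
  not depend on \<open>s\<close>. For \<open>s \<le> r\<close> the inner ball is absorbed by an outer ball of radius \<open>2 r\<close>; for \<open>s > r\<close>
  the inner integral is small pointwise, as \<open>\<phi> s \<le> C\<phi> * \<phi> r\<close>.\<close>

lemma ball_integral_ball_sum_power_le:
  assumes r: "0 < r" and s: "0 < s"
  shows "ball_integral r (\<lambda>z. ennreal (ball_sum s z powr p)) x
    \<le> ennreal (ball_const powr p * 2 powr d * C\<phi> powr p * (s powr d) powr p * r powr d * (\<phi> r * N) powr p)"
proof -
  define c where "c = ball_const * s powr d"
  have c: "0 < c" using ball_const_pos s by (simp add: c_def)
  define X where "X = (\<phi> r * N) powr p"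
  have X: "0 \<le> X" by (simp add: X_def)
  have "ball_integral r (\<lambda>z. ennreal (ball_sum s z powr p)) x \<le> ball_integral r (\<lambda>z. ennreal (c powr (p - 1)) * ball_integral s (\<lambda>z. ennreal (a z powr p)) z) x"
    unfolding c_def by (rule ball_integral_mono) (rule ball_sum_power_le[OF s])
  also have "\<dots> = ennreal (c powr (p - 1)) * ball_integral r (ball_integral s (\<lambda>z. ennreal (a z powr p))) x"
    by (rule ball_integral_cmult) measurable
  also have "ball_integral r (ball_integral s (\<lambda>z. ennreal (a z powr p))) x \<le> ennreal (c * (2 powr d * C\<phi> powr p * r powr d * X))"
  proof (cases "s \<le> r")
    case True
    have "ball_integral r (ball_integral s (\<lambda>z. ennreal (a z powr p))) x \<le> ennreal c * ball_integral (2 * r) (\<lambda>z. ennreal (a z powr p)) x"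
      unfolding c_def using s True by (intro ball_integral_comp_le) auto
    also have "\<dots> \<le> ennreal c * ennreal ((2 * r) powr d * (\<phi> (2 * r) * N) powr p)"
      using r by (intro mult_left_mono ball_integral_power_le) auto
    also have "\<dots> \<le> ennreal c * ennreal ((2 * r) powr d * (C\<phi> powr p * X))"
      unfolding X_def using r by (intro mult_left_mono ennreal_leI \<phi>_N_power_le) auto
    also have "\<dots> = ennreal (c * (2 powr d * C\<phi> powr p * r powr d * X))"
      using c X by (simp add: ennreal_mult[symmetric] powr_mult mult_ac)
    finally show ?thesis .
  next
    case False
    have "ball_integral r (ball_integral s (\<lambda>z. ennreal (a z powr p))) x \<le> ball_integral r (\<lambda>_. ennreal (s powr d * (C\<phi> powr p * X))) x"
    proof (rule ball_integral_mono)
      fix z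
      have "ball_integral s (\<lambda>z. ennreal (a z powr p)) z \<le> ennreal (s powr d * (\<phi> s * N) powr p)"
        using s by (rule ball_integral_power_le)
      also have "\<dots> \<le> ennreal (s powr d * (C\<phi> powr p * X))"
        unfolding X_def using r False by (intro ennreal_leI mult_left_mono \<phi>_N_power_le) auto
      finally show "ball_integral s (\<lambda>z. ennreal (a z powr p)) z \<le> ennreal (s powr d * (C\<phi> powr p * X))" .
    qed
    also have "\<dots> \<le> ennreal (s powr d * (C\<phi> powr p * X)) * ennreal (ball_const * r powr d)"
      using r by (rule ball_integral_const_le)
    also have "\<dots> = ennreal (c * (1 * C\<phi> powr p * r powr d * X))"
      using ball_const_pos X by (simp add: ennreal_mult[symmetric] c_def mult_ac)
    also have "\<dots> \<le> ennreal (c * (2 powr d * C\<phi> powr p * r powr d * X))"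
      using c X d_pos by (intro ennreal_leI mult_left_mono mult_right_mono ge_one_powr_ge_zero) auto
    finally show ?thesis .
  qed
  also have "ennreal (c powr (p - 1)) * ennreal (c * (2 powr d * C\<phi> powr p * r powr d * X)) =
      ennreal (ball_const powr p * 2 powr d * C\<phi> powr p * (s powr d) powr p * r powr d * X)"
  proof -
    have "c powr (p - 1) * c = ball_const powr p * (s powr d) powr p"
      using c by (simp add: powr_diff) (simp add: c_def powr_mult)
    then show ?thesis using c X by (simp add: ennreal_mult[symmetric] mult_ac)
  qed
  finally show ?thesis by (simp add: X_def mult_left_mono)
qed

text \<open>Of the \<open>q\<close> factors, \<open>p\<close> are estimated by the preceding lemma and \<open>q - p\<close> by the pointwise bound.\<close>

lemma ball_integral_ball_sum_target_power_le:
  assumes r: "0 < r" and s: "0 < s" and q: "p \<le> q"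
  shows "ball_integral r (\<lambda>z. ennreal (ball_sum s z powr q)) x
    \<le> ennreal (ball_const powr ((1 - 1 / p) * (q - p)) * (ball_const powr p * 2 powr d * C\<phi> powr p) *
        ((s powr d) powr q * \<phi> s powr (q - p)) * r powr d * (\<phi> r powr p * N powr q))"
proof -
  define E where "E = ball_const powr (1 - 1 / p) * s powr d * \<phi> s * N"
  have E: "0 \<le> E" using ball_const_pos \<phi>_pos[OF s] N by (simp add: E_def)
  have "ball_sum s z powr q \<le> E powr (q - p) * ball_sum s z powr p" for z
  proof -
    have "ball_sum s z powr q = ball_sum s z powr (q - p) * ball_sum s z powr p"
      by (simp add: powr_add[symmetric])
    also have "\<dots> \<le> E powr (q - p) * ball_sum s z powr p"
      using q ball_sum_nonneg[of s z] ball_sum_bound[OF s, of z] by (intro mult_right_mono powr_mono2) (auto simp: E_def)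
    finally show ?thesis .
  qed
  then have "ball_integral r (\<lambda>z. ennreal (ball_sum s z powr q)) x \<le> ball_integral r (\<lambda>z. ennreal (E powr (q - p)) * ennreal (ball_sum s z powr p)) x"
    by (intro ball_integral_mono) (auto simp: ennreal_mult[symmetric])
  also have "\<dots> = ennreal (E powr (q - p)) * ball_integral r (\<lambda>z. ennreal (ball_sum s z powr p)) x"
    by (rule ball_integral_cmult) measurable
  also have "\<dots> \<le> ennreal (E powr (q - p)) *
      ennreal (ball_const powr p * 2 powr d * C\<phi> powr p * (s powr d) powr p * r powr d * (\<phi> r * N) powr p)"
    using ball_integral_ball_sum_power_le[OF r s] by (rule mult_left_mono) simp
  also have "\<dots> = ennreal (E powr (q - p) *
      (ball_const powr p * 2 powr d * C\<phi> powr p * (s powr d) powr p * r powr d * (\<phi> r * N) powr p))"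
    by (simp add: ennreal_mult[symmetric])
  also have "E powr (q - p) * (ball_const powr p * 2 powr d * C\<phi> powr p * (s powr d) powr p * r powr d * (\<phi> r * N) powr p)
     = ball_const powr ((1 - 1 / p) * (q - p)) * (ball_const powr p * 2 powr d * C\<phi> powr p) *
        (((s powr d) powr (q - p) * (s powr d) powr p) * \<phi> s powr (q - p)) * r powr d *
        (\<phi> r powr p * (N powr (q - p) * N powr p))"
    unfolding E_def powr_mult powr_powr by (simp only: mult_ac)
  also have "(s powr d) powr (q - p) * (s powr d) powr p = (s powr d) powr q"
    by (simp add: powr_add[symmetric])
  also have "N powr (q - p) * N powr p = N powr q"
    by (simp add: powr_add[symmetric])
  finally show ?thesis .
qed

end

section \<open>Dyadic decomposition of the kernel\<close>

lemma nn_integral_geometric: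
  assumes "0 \<le> c" "0 < (b :: real)"
  shows "(\<integral>\<^sup>+n. ennreal (c * 2 powr (- real n * b)) \<partial>count_space UNIV) < \<infinity>"
proof -
  have eq: "2 powr (- real n * b) = (2 powr (- b)) ^ n" for n
    by (simp add: powr_powr mult.commute flip: powr_realpow)
  have "2 powr (- b) < 2 powr 0" using assms by (intro powr_less_mono) auto
  then have "summable (\<lambda>n. c * 2 powr (- real n * b))"
    unfolding eq by (intro summable_mult summable_geometric) simp
  then show ?thesis
    using assms by (simp add: nn_integral_count_space_nat suminf_ennreal2 del: ennreal_mult)
qed

lemma borel_measurable_nn_integral_int [measurable (raw)]:
  fixes f :: "int \<Rightarrow> 'a \<Rightarrow> ennreal"
  assumes [measurable]: "\<And>k. f k \<in> borel_measurable M"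
  shows "(\<lambda>x. \<integral>\<^sup>+k. f k x \<partial>count_space UNIV) \<in> borel_measurable M"
proof -
  have "(\<integral>\<^sup>+k. f k x \<partial>count_space UNIV) = (\<Sum>n. f (int_decode n) x)" for x
    using nn_integral_bij_count_space[OF bij_int_decode, of "\<lambda>k. f k x"]
    by (simp add: nn_integral_count_space_nat)
  then show ?thesis by simp
qed

context dunkl begin

definition radius :: "int \<Rightarrow> real" where
  "radius k = 2 powr (real_of_int k + 1)"

text \<open>A bound for the kernel on the shell of points \<open>z\<close> with \<open>2 powr k \<le> \<bar>z\<bar> < radius k\<close>. The first exponent is the
  order of the kernel at \<open>0\<close>, the second its order at infinity.\<close>

definition coef :: "real \<Rightarrow> real \<Rightarrow> int \<Rightarrow> real" where
  "coef \<beta> \<gamma> k = min (2 powr (real_of_int k * (\<beta> - d))) (2 powr (real_of_int k * (\<beta> - d - \<gamma>)))"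

lemma radius_pos [simp]: "0 < radius k"
  by (simp add: radius_def)

lemma coef_nonneg [simp]: "0 \<le> coef \<beta> \<gamma> k"
  by (simp add: coef_def)

lemma bessel_riesz_kernel_le_coef:
  assumes "\<beta> < d" "0 < \<gamma>" "0 < \<rho>" and k: "2 powr real_of_int k \<le> \<rho>"
  shows "bessel_riesz_kernel \<alpha> \<beta> \<gamma> \<rho> \<le> coef \<beta> \<gamma> k"
proof -
  have 1: "\<rho> powr (\<beta> - d) \<le> 2 powr (real_of_int k * (\<beta> - d))"
    using powr_mono2'[of "\<beta> - d" "2 powr real_of_int k" \<rho>] assms by (simp add: powr_powr)
  have 2: "\<rho> powr (\<beta> - d - \<gamma>) \<le> 2 powr (real_of_int k * (\<beta> - d - \<gamma>))"
    using powr_mono2'[of "\<beta> - d - \<gamma>" "2 powr real_of_int k" \<rho>] assms by (simp add: powr_powr)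
  have "bessel_riesz_kernel \<alpha> \<beta> \<gamma> \<rho> \<le> \<rho> powr (\<beta> - d) / 1"
    unfolding bessel_riesz_kernel_def using assms
    by (intro frac_le) (auto intro!: ge_one_powr_ge_zero)
  moreover have "bessel_riesz_kernel \<alpha> \<beta> \<gamma> \<rho> \<le> \<rho> powr (\<beta> - d) / \<rho> powr \<gamma>"
    unfolding bessel_riesz_kernel_def using assms
    by (intro frac_le) (auto intro!: powr_mono2)
  then have "bessel_riesz_kernel \<alpha> \<beta> \<gamma> \<rho> \<le> \<rho> powr (\<beta> - d - \<gamma>)"
    using assms by (simp add: powr_diff)
  ultimately show ?thesis using 1 2 by (simp add: coef_def)
qed

lemma bessel_riesz_kernel_dyadic:
  assumes "\<beta> < d" "0 < \<gamma>" "0 \<le> \<rho>"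
  shows "ennreal (bessel_riesz_kernel \<alpha> \<beta> \<gamma> \<rho>) \<le>
    (\<integral>\<^sup>+k. ennreal (coef \<beta> \<gamma> k) * indicator {..<radius k} \<rho> \<partial>count_space UNIV)"
proof (cases "\<rho> = 0")
  case False
  then have \<rho>: "0 < \<rho>" using assms by simp
  define k where "k = \<lfloor>log 2 \<rho>\<rfloor>"
  have "2 powr real_of_int k \<le> 2 powr (log 2 \<rho>)" "2 powr (log 2 \<rho>) < 2 powr (real_of_int k + 1)"
    unfolding k_def by (auto intro!: powr_mono powr_less_mono)
  then have k: "2 powr real_of_int k \<le> \<rho>" "\<rho> < radius k"
    using \<rho> by (simp_all add: radius_def)
  have "ennreal (bessel_riesz_kernel \<alpha> \<beta> \<gamma> \<rho>) \<le> ennreal (coef \<beta> \<gamma> k) * indicator {..<radius k} \<rho>"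
    using bessel_riesz_kernel_le_coef[OF assms(1,2) \<rho> k(1)] k(2) by (auto intro: ennreal_leI)
  also have "\<dots> \<le> (\<integral>\<^sup>+k. ennreal (coef \<beta> \<gamma> k) * indicator {..<radius k} \<rho> \<partial>count_space UNIV)"
    by (rule nn_integral_ge_point) simp
  finally show ?thesis .
qed (simp add: bessel_riesz_kernel_def)

lemma bessel_riesz_kernel_measurable [measurable]: "bessel_riesz_kernel \<alpha> \<beta> \<gamma> \<in> borel_measurable borel"
  unfolding bessel_riesz_kernel_def by measurable

text \<open>The kernel is even, so the odd part of the translation vanishes and the factor \<open>1 - cos \<theta> \<le> 2\<close> remains. If
  the integral over \<open>\<theta>\<close> diverges, the translation has the default value \<open>0\<close>.\<close>

lemma translation_kernel_le:
  assumes "\<beta> < d" "0 < \<gamma>"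
  shows "ennreal \<bar>dunkl_translation \<alpha> x (bessel_riesz_kernel \<alpha> \<beta> \<gamma>) y\<bar> \<le>
    2 * (\<integral>\<^sup>+k. ennreal (coef \<beta> \<gamma> k) * ball_weight (radius k) x y \<partial>count_space UNIV)"
proof -
  let ?K = "bessel_riesz_kernel \<alpha> \<beta> \<gamma>"
  define F where "F \<theta> = trans_integrand x ?K y \<theta> / 2" for \<theta>
  have [measurable]: "F \<in> borel_measurable borel" unfolding F_def by measurable
  have K_nonneg: "0 \<le> ?K z" for z by (simp add: bessel_riesz_kernel_def)
  have K_even: "?K (- z) = ?K z" for z by (simp add: bessel_riesz_kernel_def)
  have F_le: "ennreal \<bar>F \<theta>\<bar> \<le> 2 * ennreal (?K (dunkl_dist x y \<theta>))" for \<theta>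
  proof -
    have "F \<theta> = ?K (dunkl_dist x y \<theta>) * (1 - cos \<theta>)"
      by (simp add: F_def trans_integrand_def K_even)
    then have "\<bar>F \<theta>\<bar> = ?K (dunkl_dist x y \<theta>) * (1 - cos \<theta>)" using K_nonneg by (simp add: abs_mult)
    also have "\<dots> \<le> ?K (dunkl_dist x y \<theta>) * 2"
      using cos_ge_minus_one[of \<theta>] K_nonneg by (intro mult_left_mono) auto
    finally have "ennreal \<bar>F \<theta>\<bar> \<le> ennreal (2 * ?K (dunkl_dist x y \<theta>))" by (intro ennreal_leI) simp
    then show ?thesis using K_nonneg by (simp add: ennreal_mult)
  qed
  have "dunkl_translation \<alpha> x ?K y = (\<integral>\<theta>. F \<theta> \<partial>\<sigma>)"
    by (simp add: dunkl_translation_eq F_def)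
  also have "ennreal \<bar>\<integral>\<theta>. F \<theta> \<partial>\<sigma>\<bar> \<le> (\<integral>\<^sup>+\<theta>. ennreal \<bar>F \<theta>\<bar> \<partial>\<sigma>)"
  proof (cases "integrable \<sigma> F")
    case True
    then show ?thesis using integral_norm_bound_ennreal[OF True] by simp
  qed (simp add: not_integrable_integral_eq)
  also have "\<dots> \<le> (\<integral>\<^sup>+\<theta>. 2 * (\<integral>\<^sup>+k. ennreal (coef \<beta> \<gamma> k) * indicator {..<radius k} (dunkl_dist x y \<theta>) \<partial>count_space UNIV) \<partial>\<sigma>)"
    using F_le bessel_riesz_kernel_dyadic[OF assms]
    by (intro nn_integral_mono order.trans[OF F_le] mult_left_mono) auto
  also have "\<dots> = 2 * (\<integral>\<^sup>+\<theta>. (\<integral>\<^sup>+k. ennreal (coef \<beta> \<gamma> k) * indicator {..<radius k} (dunkl_dist x y \<theta>) \<partial>count_space UNIV) \<partial>\<sigma>)"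
    by (rule nn_integral_cmult) measurable
  also have "(\<integral>\<^sup>+\<theta>. (\<integral>\<^sup>+k. ennreal (coef \<beta> \<gamma> k) * indicator {..<radius k} (dunkl_dist x y \<theta>) \<partial>count_space UNIV) \<partial>\<sigma>) =
     (\<integral>\<^sup>+k. (\<integral>\<^sup>+\<theta>. ennreal (coef \<beta> \<gamma> k) * indicator {..<radius k} (dunkl_dist x y \<theta>) \<partial>\<sigma>) \<partial>count_space UNIV)"
    by (rule nn_integral_count_space_nn_integral) auto
  also have "\<dots> = (\<integral>\<^sup>+k. ennreal (coef \<beta> \<gamma> k) * ball_weight (radius k) x y \<partial>count_space UNIV)"
    by (simp add: ball_weight_def nn_integral_cmult)
  finally show ?thesis .
qed

text \<open>The exponent \<open>\<delta>\<close> lies strictly between the two orders of the kernel, so the terms decay geometrically in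
  both directions.\<close>

lemma coef_radius_sum:
  assumes "d - \<beta> < \<delta>" "\<delta> < d - \<beta> + \<gamma>"
  obtains W where "1 \<le> W" "(\<integral>\<^sup>+k. ennreal (coef \<beta> \<gamma> k * radius k powr \<delta>) \<partial>count_space UNIV) \<le> ennreal W"
proof -
  let ?w = "\<lambda>k. ennreal (coef \<beta> \<gamma> k * radius k powr \<delta>)"
  have w1: "coef \<beta> \<gamma> k * radius k powr \<delta> \<le> 2 powr \<delta> * 2 powr (real_of_int k * (\<delta> - (d - \<beta>)))" for k
  proof -
    have "coef \<beta> \<gamma> k * radius k powr \<delta> \<le> 2 powr (real_of_int k * (\<beta> - d)) * radius k powr \<delta>"
      by (intro mult_right_mono) (auto simp: coef_def)
    also have "\<dots> = 2 powr (real_of_int k * (\<beta> - d) + (real_of_int k + 1) * \<delta>)"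
      by (subst powr_add) (simp only: radius_def powr_powr)
    also have "real_of_int k * (\<beta> - d) + (real_of_int k + 1) * \<delta> = \<delta> + real_of_int k * (\<delta> - (d - \<beta>))"
      by (simp add: algebra_simps)
    finally show ?thesis by (simp only: powr_add)
  qed
  have w2: "coef \<beta> \<gamma> k * radius k powr \<delta> \<le> 2 powr \<delta> * 2 powr (- real_of_int k * (d - \<beta> + \<gamma> - \<delta>))" for k
  proof -
    have "coef \<beta> \<gamma> k * radius k powr \<delta> \<le> 2 powr (real_of_int k * (\<beta> - d - \<gamma>)) * radius k powr \<delta>"
      by (intro mult_right_mono) (auto simp: coef_def)
    also have "\<dots> = 2 powr (real_of_int k * (\<beta> - d - \<gamma>) + (real_of_int k + 1) * \<delta>)"
      by (subst powr_add) (simp only: radius_def powr_powr)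
    also have "real_of_int k * (\<beta> - d - \<gamma>) + (real_of_int k + 1) * \<delta> = \<delta> + - real_of_int k * (d - \<beta> + \<gamma> - \<delta>)"
      by (simp add: algebra_simps)
    finally show ?thesis by (simp only: powr_add)
  qed
  have "(\<integral>\<^sup>+k. ?w k \<partial>count_space UNIV) \<le>
      (\<integral>\<^sup>+k. ?w k * indicator {0..} k + ?w k * indicator {..0} k \<partial>count_space UNIV)"
    by (intro nn_integral_mono) (auto simp: indicator_def)
  also have "\<dots> = (\<integral>\<^sup>+k. ?w k * indicator {0..} k \<partial>count_space UNIV) + (\<integral>\<^sup>+k. ?w k * indicator {..0} k \<partial>count_space UNIV)"
    by (rule nn_integral_add) auto
  also have "(\<integral>\<^sup>+k. ?w k * indicator {0..} k \<partial>count_space UNIV) = (\<integral>\<^sup>+n. ?w (int n) \<partial>count_space UNIV)"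
  proof -
    have "bij_betw int UNIV {0..}" by (rule bij_betw_byWitness[where f' = nat]) auto
    then show ?thesis
      by (subst nn_integral_count_space_indicator[symmetric], simp, subst nn_integral_bij_count_space) auto
  qed
  also have "(\<integral>\<^sup>+k. ?w k * indicator {..0} k \<partial>count_space UNIV) = (\<integral>\<^sup>+n. ?w (- int n) \<partial>count_space UNIV)"
  proof -
    have "bij_betw (\<lambda>n. - int n) UNIV {..0}"
      by (rule bij_betw_byWitness[where f' = "\<lambda>k. nat (- k)"]) auto
    then show ?thesis
      by (subst nn_integral_count_space_indicator[symmetric], simp, subst nn_integral_bij_count_space) auto
  qed
  also have "(\<integral>\<^sup>+n. ?w (int n) \<partial>count_space UNIV) + (\<integral>\<^sup>+n. ?w (- int n) \<partial>count_space UNIV) \<le>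
     (\<integral>\<^sup>+n. ennreal (2 powr \<delta> * 2 powr (- real n * (d - \<beta> + \<gamma> - \<delta>))) \<partial>count_space UNIV) +
     (\<integral>\<^sup>+n. ennreal (2 powr \<delta> * 2 powr (- real n * (\<delta> - (d - \<beta>)))) \<partial>count_space UNIV)"
    using w1[of "- int _"] w2[of "int _"] by (intro add_mono nn_integral_mono ennreal_leI) auto
  also have "\<dots> < \<infinity>"
    using assms nn_integral_geometric[of "2 powr \<delta>"] by simp
  finally obtain w where w: "0 \<le> w" "(\<integral>\<^sup>+k. ?w k \<partial>count_space UNIV) = ennreal w"
    by (cases "\<integral>\<^sup>+k. ?w k \<partial>count_space UNIV") auto
  show ?thesis
    by (rule that[of "max 1 w"]) (use w in auto)
qed

end

section \<open>The operator on a Morrey space\<close>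

text \<open>In the application \<open>\<delta> = d / t\<close>. The assumption on \<open>\<nu>\<close> is the definition of the target exponent \<open>q\<close>; it says
  that \<open>s powr d * (s powr \<nu>) powr (1 - p / q) = s powr \<delta>\<close>.\<close>

locale morrey_estimate = morrey_function +
  fixes f :: "real \<Rightarrow> complex" and \<beta> \<gamma> q \<delta> \<nu> C\<^sub>0 W :: real
  assumes f_measurable [measurable]: "f \<in> borel_measurable borel" and a_def: "a = (\<lambda>z. norm (f z))"
    and \<beta>: "\<beta> < d" and \<gamma>: "0 < \<gamma>" and q: "p \<le> q" and C0: "0 < C\<^sub>0"
    and \<phi>_le: "\<And>r. 0 < r \<Longrightarrow> \<phi> r \<le> C\<^sub>0 * r powr \<nu>" and \<nu>: "\<nu> * (q - p) = q * (\<delta> - d)"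
    and W: "1 \<le> W" "(\<integral>\<^sup>+k. ennreal (coef \<beta> \<gamma> k * radius k powr \<delta>) \<partial>count_space UNIV) \<le> ennreal W"
begin

definition power_const :: real where
  "power_const = ball_const powr ((1 - 1 / p) * (q - p)) * (ball_const powr p * 2 powr d * C\<phi> powr p) * C\<^sub>0 powr (q - p)"

lemma power_const_nonneg: "0 \<le> power_const"
  by (simp add: power_const_def)

text \<open>By the choice of \<open>q\<close>, dividing the ball integrals of radius \<open>s\<close> by \<open>s powr \<delta>\<close> gives a bound in which \<open>s\<close> no
  longer appears.\<close>

lemma ball_integral_normalized_le:
  assumes r: "0 < r" and s: "0 < s"
  shows "ball_integral r (\<lambda>z. ennreal ((ball_sum s z / s powr \<delta>) powr q)) x \<le> ennreal (power_const * r powr d * (\<phi> r powr p * N powr q))"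
proof -
  define A where "A = ball_const powr ((1 - 1 / p) * (q - p)) * (ball_const powr p * 2 powr d * C\<phi> powr p)"
  define X where "X = \<phi> r powr p * N powr q"
  have AX: "0 \<le> A" "0 \<le> X" by (simp_all add: A_def X_def)
  define c where "c = 1 / (s powr \<delta>) powr q"
  have c: "0 \<le> c" by (simp add: c_def)
  have "ball_integral r (\<lambda>z. ennreal ((ball_sum s z / s powr \<delta>) powr q)) x = ball_integral r (\<lambda>z. ennreal c * ennreal (ball_sum s z powr q)) x"
    by (simp add: c_def powr_divide ennreal_mult[symmetric])
  also have "\<dots> = ennreal c * ball_integral r (\<lambda>z. ennreal (ball_sum s z powr q)) x"
    by (rule ball_integral_cmult) measurable
  also have "\<dots> \<le> ennreal c * ennreal (A * ((s powr d) powr q * \<phi> s powr (q - p)) * r powr d * X)"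
    unfolding A_def X_def by (intro mult_left_mono ball_integral_ball_sum_target_power_le r s q) simp
  also have "\<dots> \<le> ennreal c * ennreal (A * (C\<^sub>0 powr (q - p) * (s powr \<delta>) powr q) * r powr d * X)"
  proof (intro mult_left_mono ennreal_leI mult_right_mono)
    have "\<phi> s powr (q - p) \<le> (C\<^sub>0 * s powr \<nu>) powr (q - p)"
      using q \<phi>_le[OF s] \<phi>_pos[OF s] by (intro powr_mono2) auto
    then have "(s powr d) powr q * \<phi> s powr (q - p) \<le> (s powr d) powr q * (C\<^sub>0 * s powr \<nu>) powr (q - p)"
      by (rule mult_left_mono) simp
    also have "\<dots> = C\<^sub>0 powr (q - p) * (s powr (d * q) * s powr (\<nu> * (q - p)))"
      by (simp add: powr_mult powr_powr)
    also have "s powr (d * q) * s powr (\<nu> * (q - p)) = (s powr \<delta>) powr q"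
      unfolding \<nu> powr_powr by (simp add: powr_add[symmetric] algebra_simps)
    finally show "(s powr d) powr q * \<phi> s powr (q - p) \<le> C\<^sub>0 powr (q - p) * (s powr \<delta>) powr q" .
  qed (use AX in auto)
  also have "\<dots> = ennreal (c * (A * (C\<^sub>0 powr (q - p) * (s powr \<delta>) powr q) * r powr d * X))"
    using c AX by (simp add: ennreal_mult[symmetric])
  also have "c * (A * (C\<^sub>0 powr (q - p) * (s powr \<delta>) powr q) * r powr d * X) = power_const * r powr d * X"
    using s by (simp add: c_def power_const_def A_def)
  finally show ?thesis by (simp add: X_def)
qed

definition weight :: "int \<Rightarrow> ennreal" where
  "weight k = ennreal (coef \<beta> \<gamma> k * radius k powr \<delta>)"

definition scaled_sum :: "int \<Rightarrow> real \<Rightarrow> real" where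
  "scaled_sum k z = ball_sum (radius k) z / radius k powr \<delta>"

definition power_series :: "real \<Rightarrow> ennreal" where
  "power_series z = (\<integral>\<^sup>+k. ennreal (scaled_sum k z powr q) * weight k \<partial>count_space UNIV)"

text \<open>The series that dominates the operator. It is the sum of \<open>scaled_sum k\<close> with the weights \<open>weight k\<close>, whose
  total mass is at most \<open>W\<close>; \<open>power_series\<close> is the sum of the \<open>q\<close>-th powers with the same weights.\<close>

definition dyadic_series :: "real \<Rightarrow> ennreal" where
  "dyadic_series z = (\<integral>\<^sup>+k. ennreal (coef \<beta> \<gamma> k) * ball_integral (radius k) (\<lambda>y. ennreal (a y)) z \<partial>count_space UNIV)"

lemma scaled_sum_nonneg: "0 \<le> scaled_sum k z"
  by (simp add: scaled_sum_def ball_sum_nonneg)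

lemma scaled_sum_measurable [measurable]: "scaled_sum k \<in> borel_measurable borel"
  unfolding scaled_sum_def by measurable

lemma power_series_measurable [measurable]: "power_series \<in> borel_measurable borel"
  unfolding power_series_def by measurable

lemma ball_integral_power_series_le:
  assumes r: "0 < r"
  shows "ball_integral r power_series x \<le> ennreal (W * power_const * r powr d * (\<phi> r powr p * N powr q))"
proof -
  define X where "X = power_const * r powr d * (\<phi> r powr p * N powr q)"
  have X: "0 \<le> X" using power_const_nonneg by (simp add: X_def)
  have "ball_integral r power_series x = (\<integral>\<^sup>+z. \<integral>\<^sup>+k. ennreal (scaled_sum k z powr q) * weight k * ball_weight r x z \<partial>count_space UNIV \<partial>\<mu>)"
    unfolding ball_integral_def power_series_def by (simp add: nn_integral_multc)
  also have "\<dots> = (\<integral>\<^sup>+k. \<integral>\<^sup>+z. ennreal (scaled_sum k z powr q) * weight k * ball_weight r x z \<partial>\<mu> \<partial>count_space UNIV)"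
    by (rule nn_integral_count_space_nn_integral) auto
  also have "\<dots> = (\<integral>\<^sup>+k. weight k * ball_integral r (\<lambda>z. ennreal (scaled_sum k z powr q)) x \<partial>count_space UNIV)"
    unfolding ball_integral_def by (intro nn_integral_cong, subst nn_integral_cmult[symmetric]) (auto simp: mult_ac)
  also have "\<dots> \<le> (\<integral>\<^sup>+k. weight k * ennreal X \<partial>count_space UNIV)"
    unfolding scaled_sum_def X_def by (intro nn_integral_mono mult_left_mono ball_integral_normalized_le r) auto
  also have "\<dots> = (\<integral>\<^sup>+k. weight k \<partial>count_space UNIV) * ennreal X"
    by (rule nn_integral_multc) simp
  also have "\<dots> \<le> ennreal W * ennreal X"
    using W(2) by (intro mult_right_mono) (auto simp: weight_def)
  also have "\<dots> = ennreal (W * X)"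
    using W(1) X by (simp add: ennreal_mult)
  finally show ?thesis by (simp add: X_def mult.assoc)
qed

text \<open>Jensen's inequality for the summation over \<open>k\<close>.\<close>

lemma dyadic_series_power_le:
  assumes "power_series z < \<infinity>"
  shows "dyadic_series z < \<infinity>" "ennreal (enn2real (dyadic_series z) powr q) \<le> ennreal (W powr (q - 1)) * power_series z"
proof -
  have q1: "1 \<le> q" using p q by simp
  obtain I where I: "0 \<le> I" "power_series z = ennreal I" using assms by (cases "power_series z") auto
  have "dyadic_series z = (\<integral>\<^sup>+k. ennreal (scaled_sum k z) * weight k \<partial>count_space UNIV)"
    unfolding dyadic_series_def
  proof (rule nn_integral_cong)
    fix k
    have "coef \<beta> \<gamma> k * ball_sum (radius k) z = scaled_sum k z * (coef \<beta> \<gamma> k * radius k powr \<delta>)"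
      by (simp add: scaled_sum_def radius_def)
    then show "ennreal (coef \<beta> \<gamma> k) * ball_integral (radius k) (\<lambda>y. ennreal (a y)) z = ennreal (scaled_sum k z) * weight k"
      by (simp add: ball_integral_eq_ball_sum weight_def ennreal_mult[symmetric] ball_sum_nonneg scaled_sum_nonneg)
  qed
  also have "\<dots> \<le> ennreal (W * (I / W) powr (1 / q))"
  proof (rule nn_integral_jensen[where p = q])
    show "(\<integral>\<^sup>+k. weight k \<partial>count_space UNIV) \<le> ennreal W" using W(2) by (simp add: weight_def)
    show "(\<integral>\<^sup>+k. ennreal (scaled_sum k z powr q) * weight k \<partial>count_space UNIV) \<le> ennreal (W * ((I / W) powr (1 / q)) powr q)"
      using I W(1) q1 by (simp add: power_series_def powr_powr)
  qed (use W(1) I q1 scaled_sum_nonneg in auto)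
  finally have dyadic_series: "dyadic_series z \<le> ennreal (W * (I / W) powr (1 / q))" .
  then show fin: "dyadic_series z < \<infinity>" by (rule le_less_trans) simp
  have "enn2real (dyadic_series z) \<le> W * (I / W) powr (1 / q)"
    using dyadic_series W(1) by (intro enn2real_leI) auto
  then have "enn2real (dyadic_series z) powr q \<le> (W * (I / W) powr (1 / q)) powr q"
    using q1 by (intro powr_mono2) auto
  also have "\<dots> = W powr (q - 1) * I"
    using q1 W(1) I by (simp add: powr_mult powr_powr powr_diff)
  finally show "ennreal (enn2real (dyadic_series z) powr q) \<le> ennreal (W powr (q - 1)) * power_series z"
    using I by (simp add: ennreal_mult[symmetric])
qed

text \<open>The ball weight with centre \<open>0\<close> is the indicator of an interval, so the series is integrable over every
  bounded interval.\<close>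

lemma AE_power_series_finite: "AE z in \<mu>. power_series z < \<infinity>"
proof -
  have "AE z in \<mu>. \<forall>n::nat. power_series z * ball_weight (real (Suc n)) 0 z \<noteq> \<infinity>"
  proof (subst AE_all_countable, intro allI nn_integral_PInf_AE)
    fix n
    show "(\<integral>\<^sup>+z. power_series z * ball_weight (real (Suc n)) 0 z \<partial>\<mu>) \<noteq> \<infinity>"
      using ball_integral_power_series_le[of "real (Suc n)" 0] by (auto simp: ball_integral_def top_unique)
  qed measurable
  then show ?thesis
  proof eventually_elim
    case (elim z)
    obtain n where "\<bar>z\<bar> < real n" using reals_Archimedean2 by blast
    then have "z \<in> {-real (Suc n)<..<real (Suc n)}" by auto
    then show ?case using elim[rule_format, of n] by (simp add: ball_weight_zero less_top)
  qed
qed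

lemma translation_measurable [measurable (raw)]:
  assumes [measurable]: "g \<in> borel_measurable borel" "x \<in> borel_measurable M" "y \<in> borel_measurable M"
  shows "(\<lambda>weight. dunkl_translation \<alpha> (x weight) g (y weight)) \<in> borel_measurable M"
  by (simp add: dunkl_translation_eq)

lemma nn_integral_integrand_le:
  "(\<integral>\<^sup>+y. ennreal (norm (bessel_riesz_integrand \<alpha> \<beta> \<gamma> f x y)) \<partial>\<mu>) \<le> 2 * dyadic_series x"
proof -
  have "(\<integral>\<^sup>+y. ennreal (norm (bessel_riesz_integrand \<alpha> \<beta> \<gamma> f x y)) \<partial>\<mu>) \<le>
      (\<integral>\<^sup>+y. \<integral>\<^sup>+k. 2 * (ennreal (coef \<beta> \<gamma> k) * (ennreal (a y) * ball_weight (radius k) x y)) \<partial>count_space UNIV \<partial>\<mu>)"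
  proof (rule nn_integral_mono)
    fix y
    have "ennreal (norm (bessel_riesz_integrand \<alpha> \<beta> \<gamma> f x y)) =
        ennreal (a y) * ennreal \<bar>dunkl_translation \<alpha> x (bessel_riesz_kernel \<alpha> \<beta> \<gamma>) y\<bar>"
      by (simp add: bessel_riesz_integrand_def norm_mult a_def ennreal_mult)
    also have "\<dots> \<le> ennreal (a y) * (2 * (\<integral>\<^sup>+k. ennreal (coef \<beta> \<gamma> k) * ball_weight (radius k) x y \<partial>count_space UNIV))"
      by (intro mult_left_mono translation_kernel_le \<beta> \<gamma>) simp
    also have "\<dots> = (\<integral>\<^sup>+k. 2 * (ennreal (coef \<beta> \<gamma> k) * (ennreal (a y) * ball_weight (radius k) x y)) \<partial>count_space UNIV)"
      by (subst nn_integral_cmult[symmetric], simp, subst nn_integral_cmult[symmetric], simp)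
         (intro nn_integral_cong, simp add: mult_ac)
    finally show "ennreal (norm (bessel_riesz_integrand \<alpha> \<beta> \<gamma> f x y)) \<le>
        (\<integral>\<^sup>+k. 2 * (ennreal (coef \<beta> \<gamma> k) * (ennreal (a y) * ball_weight (radius k) x y)) \<partial>count_space UNIV)" .
  qed
  also have "\<dots> = (\<integral>\<^sup>+k. \<integral>\<^sup>+y. 2 * (ennreal (coef \<beta> \<gamma> k) * (ennreal (a y) * ball_weight (radius k) x y)) \<partial>\<mu> \<partial>count_space UNIV)"
    by (rule nn_integral_count_space_nn_integral) auto
  also have "\<dots> = 2 * dyadic_series x"
    by (simp add: dyadic_series_def ball_integral_def nn_integral_cmult)
  finally show ?thesis .
qed

lemma bessel_riesz_integrand_measurable [measurable]:
  "(\<lambda>(x, y). bessel_riesz_integrand \<alpha> \<beta> \<gamma> f x y) \<in> borel_measurable (borel \<Otimes>\<^sub>M borel)"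
  unfolding bessel_riesz_integrand_def by measurable

lemma AE_integrable_integrand: "AE x in \<mu>. integrable \<mu> (bessel_riesz_integrand \<alpha> \<beta> \<gamma> f x)"
  using AE_power_series_finite
proof eventually_elim
  case (elim x)
  have "(\<integral>\<^sup>+y. ennreal (norm (bessel_riesz_integrand \<alpha> \<beta> \<gamma> f x y)) \<partial>\<mu>) < \<infinity>"
    using nn_integral_integrand_le[of x] dyadic_series_power_le(1)[OF elim]
    by (auto simp: ennreal_mult_less_top elim!: le_less_trans)
  then show ?case by (intro integrableI_bounded) measurable
qed

lemma bessel_riesz_measurable [measurable]: "bessel_riesz \<alpha> \<beta> \<gamma> f \<in> borel_measurable borel"
  unfolding bessel_riesz_def[abs_def] by measurable

lemma AE_bessel_riesz_power_le:
  "AE x in \<mu>. ennreal (norm (bessel_riesz \<alpha> \<beta> \<gamma> f x) powr q) \<le> ennreal (2 powr q * W powr (q - 1)) * power_series x"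
  using AE_power_series_finite AE_integrable_integrand
proof eventually_elim
  case (elim x)
  have q1: "1 \<le> q" using p q by simp
  have dyadic_series: "dyadic_series x = ennreal (enn2real (dyadic_series x))" using dyadic_series_power_le(1)[OF elim(1)] by simp
  have "ennreal (norm (bessel_riesz \<alpha> \<beta> \<gamma> f x)) \<le> 2 * dyadic_series x"
    unfolding bessel_riesz_def
    by (rule order.trans[OF integral_norm_bound_ennreal[OF elim(2)] nn_integral_integrand_le])
  also have "\<dots> = ennreal (2 * enn2real (dyadic_series x))"
    by (subst dyadic_series) (simp add: ennreal_mult)
  finally have "norm (bessel_riesz \<alpha> \<beta> \<gamma> f x) \<le> 2 * enn2real (dyadic_series x)" by simp
  then have "norm (bessel_riesz \<alpha> \<beta> \<gamma> f x) powr q \<le> (2 * enn2real (dyadic_series x)) powr q"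
    using q1 by (intro powr_mono2) auto
  then have "ennreal (norm (bessel_riesz \<alpha> \<beta> \<gamma> f x) powr q) \<le> ennreal (2 powr q) * ennreal (enn2real (dyadic_series x) powr q)"
    by (simp add: powr_mult ennreal_mult[symmetric])
  also have "\<dots> \<le> ennreal (2 powr q) * (ennreal (W powr (q - 1)) * power_series x)"
    by (intro mult_left_mono dyadic_series_power_le(2) elim(1)) simp
  finally show ?case by (simp add: ennreal_mult mult.assoc)
qed

lemma ball_integral_bessel_riesz_power_le:
  assumes r: "0 < r"
  shows "ball_integral r (\<lambda>z. ennreal (norm (bessel_riesz \<alpha> \<beta> \<gamma> f z) powr q)) x
    \<le> ennreal (2 powr q * W powr q * power_const * r powr d * (\<phi> r powr p * N powr q))"
proof -
  define c where "c = 2 powr q * W powr (q - 1)"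
  have c: "0 \<le> c" by (simp add: c_def)
  have "ball_integral r (\<lambda>z. ennreal (norm (bessel_riesz \<alpha> \<beta> \<gamma> f z) powr q)) x \<le> ball_integral r (\<lambda>z. ennreal c * power_series z) x"
    unfolding ball_integral_def c_def
    using AE_bessel_riesz_power_le by (intro nn_integral_mono_AE) (auto elim!: eventually_mono intro: mult_right_mono)
  also have "\<dots> = ennreal c * ball_integral r power_series x" by (rule ball_integral_cmult) measurable
  also have "\<dots> \<le> ennreal c * ennreal (W * power_const * r powr d * (\<phi> r powr p * N powr q))"
    by (intro mult_left_mono ball_integral_power_series_le r) simp
  also have "\<dots> = ennreal (2 powr q * (W powr (q - 1) * W) * power_const * r powr d * (\<phi> r powr p * N powr q))"
    using power_const_nonneg W(1) by (simp add: ennreal_mult[symmetric] c_def mult_ac)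
  also have "W powr (q - 1) * W = W powr q" using W(1) by (simp add: powr_diff)
  finally show ?thesis .
qed

end

section \<open>Morrey norms and the boundedness theorem\<close>

context dunkl begin

lemma nn_integral_ball_finite:
  assumes "dunkl_locally_integrable \<alpha> p f"
  shows "(\<integral>\<^sup>+z. ennreal (norm (f z) powr p) * indicator {-R<..<R} z \<partial>\<mu>) < \<infinity>"
proof -
  have "set_integrable \<mu> {-R..R} (\<lambda>x. norm (f x) powr p)"
    using assms by (simp add: dunkl_locally_integrable_def)
  then have "(\<integral>\<^sup>+z. ennreal (norm (indicator {-R..R} z *\<^sub>R norm (f z) powr p)) \<partial>\<mu>) < \<infinity>"
    by (simp add: set_integrable_def integrable_iff_bounded)
  moreover have "(\<integral>\<^sup>+z. ennreal (norm (f z) powr p) * indicator {-R<..<R} z \<partial>\<mu>) \<le>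
      (\<integral>\<^sup>+z. ennreal (norm (indicator {-R..R} z *\<^sub>R norm (f z) powr p)) \<partial>\<mu>)"
    by (intro nn_integral_mono) (auto simp: indicator_def)
  ultimately show ?thesis by (rule le_less_trans[rotated])
qed

lemma ball_integral_finite:
  assumes "dunkl_locally_integrable \<alpha> p f"
  shows "ball_integral r (\<lambda>z. ennreal (norm (f z) powr p)) x < \<infinity>"
proof -
  have [measurable]: "f \<in> borel_measurable borel" using assms by (simp add: dunkl_locally_integrable_def)
  show ?thesis
    by (rule le_less_trans[OF ball_integral_le_ball nn_integral_ball_finite[OF assms]]) measurable
qed

text \<open>The two integrals \<open>J x\<close> and \<open>J (-x)\<close> are nonnegative and add up to twice the ball integral, so each of them is
  bounded by this sum. Conversely, a bound for both of them bounds the ball integral, which is the next lemma.\<close>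

lemma morrey_norm_leI:
  assumes loc: "dunkl_locally_integrable \<alpha> p f" and p: "0 < p" and \<phi>: "\<And>r. 0 < r \<Longrightarrow> 0 < \<phi> r" and M: "0 \<le> M"
    and bound: "\<And>r x. 0 < r \<Longrightarrow> ball_integral r (\<lambda>z. ennreal (norm (f z) powr p)) x \<le> ennreal (r powr d * (\<phi> r * M) powr p / 2)"
  shows "dunkl_morrey_norm \<alpha> p \<phi> f \<le> ennreal M"
  unfolding dunkl_morrey_norm_def
proof (rule SUP_least)
  fix i :: "real \<times> real"
  assume "i \<in> {0<..} \<times> UNIV"
  then obtain r x where i: "i = (r, x)" and r: "0 < r" by auto
  have [measurable]: "f \<in> borel_measurable borel" using loc by (simp add: dunkl_locally_integrable_def)
  define J where "J x = (LINT y:{-r<..<r}|\<mu>. dunkl_translation \<alpha> x (\<lambda>z. norm (f z) powr p) y)" for x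
  have J: "0 \<le> J x" for x
    unfolding J_def by (rule integral_translation_nonneg[OF _ _ ball_integral_finite[OF loc]]) auto
  have "ennreal (J x + J (- x)) = 2 * ball_integral r (\<lambda>z. ennreal (norm (f z) powr p)) x"
    unfolding J_def by (rule integral_translation_add[OF _ _ ball_integral_finite[OF loc]]) auto
  also have "\<dots> \<le> 2 * ennreal (r powr d * (\<phi> r * M) powr p / 2)"
    using r by (intro mult_left_mono bound) auto
  also have "\<dots> = ennreal (2 * (r powr d * (\<phi> r * M) powr p / 2))"
    by (subst ennreal_mult) auto
  finally have "J x + J (- x) \<le> r powr d * (\<phi> r * M) powr p"
    by (simp add: ennreal_le_iff)
  then have "J x \<le> r powr d * (\<phi> r * M) powr p" using J[of "- x"] by simp
  then have "(1 / r powr d * J x) powr (1 / p) \<le> ((\<phi> r * M) powr p) powr (1 / p)"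
    using r J[of x] p by (intro powr_mono2) (auto simp: field_simps)
  also have "\<dots> = \<phi> r * M" using r p \<phi>[of r] M by (simp add: powr_powr)
  finally have "1 / \<phi> r * (1 / r powr d * J x) powr (1 / p) \<le> M"
    using r \<phi>[of r] by (simp add: field_simps)
  then show "(case i of (r, x) \<Rightarrow> ennreal (1 / \<phi> r * (1 / r powr d *
      (LINT y:{-r<..<r}|\<mu>. dunkl_translation \<alpha> x (\<lambda>z. norm (f z) powr p) y)) powr (1 / p))) \<le> ennreal M"
    unfolding J_def i prod.case by (rule ennreal_leI)
qed

lemma ball_integral_le_morrey_norm:
  assumes loc: "dunkl_locally_integrable \<alpha> p f" and p: "0 < p" and \<phi>: "0 < \<phi> r" and r: "0 < r"
    and N: "0 \<le> N" "dunkl_morrey_norm \<alpha> p \<phi> f = ennreal N"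
  shows "ball_integral r (\<lambda>z. ennreal (norm (f z) powr p)) x \<le> ennreal (r powr d * (\<phi> r * N) powr p)"
proof -
  have [measurable]: "f \<in> borel_measurable borel" using loc by (simp add: dunkl_locally_integrable_def)
  define J where "J x = (LINT y:{-r<..<r}|\<mu>. dunkl_translation \<alpha> x (\<lambda>z. norm (f z) powr p) y)" for x
  have J: "0 \<le> J x" for x
    unfolding J_def by (rule integral_translation_nonneg[OF _ _ ball_integral_finite[OF loc]]) auto
  have J_le: "J x \<le> r powr d * (\<phi> r * N) powr p" for x
  proof -
    have "ennreal (1 / \<phi> r * (1 / r powr d * J x) powr (1 / p)) \<le> dunkl_morrey_norm \<alpha> p \<phi> f"
      unfolding dunkl_morrey_norm_def J_def
      using r by (intro SUP_upper2[of "(r, x)"]) auto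
    then have "1 / \<phi> r * (1 / r powr d * J x) powr (1 / p) \<le> N"
      using N by (simp add: ennreal_le_iff)
    then have "(1 / r powr d * J x) powr (1 / p) \<le> \<phi> r * N"
      using \<phi> by (simp add: field_simps)
    then have "((1 / r powr d * J x) powr (1 / p)) powr p \<le> (\<phi> r * N) powr p"
      using p by (intro powr_mono2) auto
    then show ?thesis
      using J[of x] r p by (simp add: powr_powr field_simps)
  qed
  have "2 * ball_integral r (\<lambda>z. ennreal (norm (f z) powr p)) x = ennreal (J x + J (- x))"
    unfolding J_def by (rule integral_translation_add[OF _ _ ball_integral_finite[OF loc], symmetric]) auto
  also have "\<dots> \<le> ennreal (2 * (r powr d * (\<phi> r * N) powr p))"
    using J_le[of x] J_le[of "- x"] by (intro ennreal_leI) simp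
  also have "\<dots> = 2 * ennreal (r powr d * (\<phi> r * N) powr p)"
    by (subst ennreal_mult) auto
  finally show ?thesis
    by (simp add: ennreal_mult_le_mult_iff)
qed

text \<open>The kernel is positive off \<open>0\<close>. An infinite norm is admitted; then \<open>\<kappa> = 1\<close> will do.\<close>

lemma bessel_riesz_kernel_norm_pos:
  obtains \<kappa> where "0 < \<kappa>" "ennreal \<kappa> \<le> dunkl_Lnorm \<alpha> t (bessel_riesz_kernel \<alpha> \<beta> \<gamma>)"
proof -
  define I where "I = (\<integral>\<^sup>+ x. ennreal (\<bar>bessel_riesz_kernel \<alpha> \<beta> \<gamma> x\<bar> powr t) \<partial>\<mu>)"
  have "I \<noteq> 0"
  proof
    assume "I = 0"
    then have "AE x in \<mu>. ennreal (\<bar>bessel_riesz_kernel \<alpha> \<beta> \<gamma> x\<bar> powr t) = 0"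
      unfolding I_def by (subst (asm) nn_integral_0_iff_AE) auto
    then have "AE x in lborel. 0 < ennreal (dunkl_density \<alpha> x) \<longrightarrow> ennreal (\<bar>bessel_riesz_kernel \<alpha> \<beta> \<gamma> x\<bar> powr t) = 0"
      unfolding dunkl_measure_eq by (subst (asm) AE_density) auto
    then have "AE x in lborel. x \<notin> {1<..<2 :: real}"
    proof eventually_elim
      case (elim x)
      show ?case
      proof
        assume "x \<in> {1<..<2}"
        then have "0 < dunkl_density \<alpha> x" "0 < bessel_riesz_kernel \<alpha> \<beta> \<gamma> x"
          using dunkl_density_pos[OF alpha, of x] by (auto simp: bessel_riesz_kernel_def)
        then show False using elim by simp
      qed
    qed
    then have "emeasure lborel {1<..<2 :: real} = 0"
      by (subst (asm) AE_iff_measurable[where N = "{1<..<2}"]) auto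
    then show False by simp
  qed
  show ?thesis
  proof (cases "I = \<infinity>")
    case True
    then show ?thesis using that[of 1] by (simp add: dunkl_Lnorm_def I_def[symmetric])
  next
    case False
    then have "0 < enn2real I" using \<open>I \<noteq> 0\<close> by (simp add: enn2real_positive_iff less_top zero_less_iff_neq_zero)
    then show ?thesis
      using that[of "enn2real I powr (1 / t)"] False by (simp add: dunkl_Lnorm_def I_def[symmetric])
  qed
qed

end

text \<open>Let \<open>t > 1\<close>. From \<open>t < d / (d - \<beta>)\<close> follows \<open>t' > d / \<beta>\<close>, hence \<open>\<nu> * t' < -d\<close>: numerator and denominator of \<open>q\<close> are both
  negative and \<open>p / q = 1 + d / (\<nu> * t')\<close> is at most \<open>1\<close>. The second relation is this equation multiplied out.\<close>

lemma target_exponent: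
  fixes d \<beta> t t' p q \<nu> :: real
  assumes "0 < \<beta>" "\<beta> < d" "1 < p" "1 \<le> t" "t < d / (d - \<beta>)" "\<nu> < - \<beta>"
    and "1 < t \<Longrightarrow> 1 / t + 1 / t' = 1"
    and "1 < t \<Longrightarrow> q = \<nu> * t' * p / (\<nu> * t' + d)"
    and "t = 1 \<Longrightarrow> q = p"
  shows "p \<le> q" "\<nu> * (q - p) = q * (d / t - d)"
proof -
  have "p \<le> q \<and> \<nu> * (q - p) = q * (d / t - d)"
  proof (cases "t = 1")
    case True
    then show ?thesis using assms(9) by simp
  next
    case False
    then have t: "1 < t" using assms(4) by simp
    have t': "1 / t' = 1 - 1 / t" using assms(7)[OF t] by simp
    have "0 < 1 / t'" unfolding t' using t by simp
    then have t'_pos: "0 < t'" by simp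
    have "t * (d - \<beta>) < d" using assms by (simp add: pos_less_divide_eq)
    then have "1 / t' < \<beta> / d" unfolding t' using t assms by (simp add: field_simps)
    then have "d < \<beta> * t'" using t'_pos assms by (simp add: field_simps)
    also have "\<beta> * t' < - \<nu> * t'" using mult_strict_right_mono[of \<beta> "- \<nu>" t'] t'_pos assms(6) by simp
    finally have neg: "\<nu> * t' + d < 0" by simp
    have q: "q * (\<nu> * t' + d) = \<nu> * t' * p" using assms(8)[OF t] neg by simp
    have "(p - q) * (\<nu> * t' + d) = d * p"
      using q by (simp add: algebra_simps)
    moreover have "0 < d * p" using assms by simp
    ultimately have "p \<le> q" using neg by (smt (verit) mult_nonneg_nonpos)
    have "d / t - d = - (d * (1 - 1 / t))" by (simp add: algebra_simps)
    then have eq: "d / t - d = - d / t'" unfolding t'[symmetric] by simp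
    have "\<nu> * (q - p) * t' = - q * d" using q by (simp add: algebra_simps)
    then have "\<nu> * (q - p) = q * (d / t - d)" unfolding eq using t'_pos by (simp add: field_simps)
    with \<open>p \<le> q\<close> show ?thesis by simp
  qed
  then show "p \<le> q" "\<nu> * (q - p) = q * (d / t - d)" by auto
qed

theorem theorem4p1:
  fixes \<alpha> \<beta> \<gamma> p t t' q \<nu> C\<^sub>0 :: real and \<phi> \<psi> :: "real \<Rightarrow> real"
  assumes "- 1 / 2 \<le> \<alpha>" "0 < \<beta>" "\<beta> < dunkl_dim \<alpha>" "0 < \<gamma>" "1 < p"
    and "dunkl_dim \<alpha> / (dunkl_dim \<alpha> + \<gamma> - \<beta>) < t" "t < dunkl_dim \<alpha> / (dunkl_dim \<alpha> - \<beta>)" "1 \<le> t"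
    and "\<And>r. 0 < r \<Longrightarrow> 0 < \<phi> r"
    and "\<phi> \<in> borel_measurable (lebesgue_on {0<..})"
    and "almost_decreasing \<phi>"
    and "almost_increasing (\<lambda>r. r powr (dunkl_dim \<alpha> / p) * \<phi> r)"
    and "\<nu> < - \<beta>" "0 < C\<^sub>0" "\<And>r. 0 < r \<Longrightarrow> \<phi> r \<le> C\<^sub>0 * r powr \<nu>"
    and "1 < t \<Longrightarrow> 1 / t + 1 / t' = 1"
    and "1 < t \<Longrightarrow> q = \<nu> * t' * p / (\<nu> * t' + dunkl_dim \<alpha>)"
    and "t = 1 \<Longrightarrow> q = p"
    and "\<And>r. 0 < r \<Longrightarrow> \<psi> r = \<phi> r powr (p / q)"
  shows "\<exists>C>0. \<forall>f \<in> dunkl_morrey \<alpha> p \<phi>.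
           (AE x in dunkl_measure \<alpha>.
              integrable (dunkl_measure \<alpha>) (bessel_riesz_integrand \<alpha> \<beta> \<gamma> f x)) \<and>
           bessel_riesz \<alpha> \<beta> \<gamma> f \<in> dunkl_morrey \<alpha> q \<psi> \<and>
           dunkl_morrey_norm \<alpha> q \<psi> (bessel_riesz \<alpha> \<beta> \<gamma> f)
             \<le> ennreal C * dunkl_Lnorm \<alpha> t (bessel_riesz_kernel \<alpha> \<beta> \<gamma>) * dunkl_morrey_norm \<alpha> p \<phi> f"
proof -
  interpret dunkl \<alpha> using assms(1) by unfold_locales simp
  define \<delta> where "\<delta> = d / t"
  note \<phi>_pos = assms(9)
  have \<delta>: "d - \<beta> < \<delta>" "\<delta> < d - \<beta> + \<gamma>"
  proof -
    have "t * (d - \<beta>) < d" using assms by (simp add: pos_less_divide_eq)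
    then show "d - \<beta> < \<delta>" using assms(8) by (simp add: \<delta>_def pos_less_divide_eq mult.commute)
    have "d < t * (d + \<gamma> - \<beta>)" using assms by (simp add: pos_divide_less_eq)
    then show "\<delta> < d - \<beta> + \<gamma>" 
      unfolding \<delta>_def using assms(8) by (subst pos_divide_less_eq) (auto simp: algebra_simps)
  qed
  have pq: "p \<le> q" and \<nu>: "\<nu> * (q - p) = q * (\<delta> - d)"
    unfolding \<delta>_def using target_exponent[OF assms(2,3,5,8,7,13,16-18)] by auto
  have q: "1 < q" using pq assms(5) by simp
  obtain W where W: "1 \<le> W" "(\<integral>\<^sup>+k. ennreal (coef \<beta> \<gamma> k * radius k powr \<delta>) \<partial>count_space UNIV) \<le> ennreal W"
    using coef_radius_sum[OF \<delta>] by blast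
  obtain c where c: "0 < c" "\<And>r s. 0 < r \<Longrightarrow> r \<le> s \<Longrightarrow> c * \<phi> s \<le> \<phi> r"
    using assms(11) unfolding almost_decreasing_def by blast
  define C\<phi> where "C\<phi> = max 1 (1 / c)"
  have dec: "\<phi> s \<le> C\<phi> * \<phi> r" if "0 < r" "r \<le> s" for r s
  proof -
    have "\<phi> s \<le> 1 / c * \<phi> r" using c(1) c(2)[OF that] by (simp add: field_simps)
    also have "\<dots> \<le> C\<phi> * \<phi> r" using \<phi>_pos[OF that(1)] by (intro mult_right_mono) (auto simp: C\<phi>_def)
    finally show ?thesis .
  qed
  obtain \<kappa> where \<kappa>: "0 < \<kappa>" "ennreal \<kappa> \<le> dunkl_Lnorm \<alpha> t (bessel_riesz_kernel \<alpha> \<beta> \<gamma>)"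
    by (rule bessel_riesz_kernel_norm_pos)
  define A where "A = ball_const powr ((1 - 1 / p) * (q - p)) * (ball_const powr p * 2 powr d * C\<phi> powr p) * C\<^sub>0 powr (q - p)"
  have A: "0 < A" using ball_const_pos assms(14) by (simp add: A_def C\<phi>_def)
  \<comment> \<open>The factor \<open>2\<close> in front pays for the passage from ball integrals to the Morrey norm.\<close>
  define B where "B = (2 * (2 powr q * W powr q * A)) powr (1 / q)"
  have B: "0 < B" using W A by (simp add: B_def)
  have Bq: "B powr q = 2 * (2 powr q * W powr q * A)" using q A W by (simp add: B_def powr_powr)
  have \<psi>_pos: "0 < \<psi> r" if "0 < r" for r
    using assms(19)[OF that] \<phi>_pos[OF that] by simp
  have main: "(AE x in \<mu>. integrable \<mu> (bessel_riesz_integrand \<alpha> \<beta> \<gamma> f x)) \<and>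
      bessel_riesz \<alpha> \<beta> \<gamma> f \<in> dunkl_morrey \<alpha> q \<psi> \<and>
      dunkl_morrey_norm \<alpha> q \<psi> (bessel_riesz \<alpha> \<beta> \<gamma> f)
        \<le> ennreal (B / \<kappa>) * dunkl_Lnorm \<alpha> t (bessel_riesz_kernel \<alpha> \<beta> \<gamma>) * dunkl_morrey_norm \<alpha> p \<phi> f"
    if f: "f \<in> dunkl_morrey \<alpha> p \<phi>" for f
  proof -
    have loc: "dunkl_locally_integrable \<alpha> p f" and fin: "dunkl_morrey_norm \<alpha> p \<phi> f < \<infinity>"
      using f by (auto simp: dunkl_morrey_def)
    have [measurable]: "f \<in> borel_measurable borel" using loc by (simp add: dunkl_locally_integrable_def)
    obtain N where N: "0 \<le> N" "dunkl_morrey_norm \<alpha> p \<phi> f = ennreal N"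
      using fin by (cases "dunkl_morrey_norm \<alpha> p \<phi> f") auto
    interpret est: morrey_estimate \<alpha> "\<lambda>z. norm (f z)" \<phi> p N C\<phi> f \<beta> \<gamma> q \<delta> \<nu> C\<^sub>0 W
      by unfold_locales
         (use assms(3-5,14,15) N(1) \<phi>_pos dec pq \<nu> W ball_integral_le_morrey_norm[OF loc _ _ _ N] in \<open>auto simp: C\<phi>_def\<close>)
    let ?g = "bessel_riesz \<alpha> \<beta> \<gamma> f"
    have bound: "ball_integral r (\<lambda>z. ennreal (norm (?g z) powr q)) x \<le> ennreal (r powr d * (\<psi> r * (B * N)) powr q / 2)"
      if r: "0 < r" for r x
    proof -
      have "(\<psi> r * (B * N)) powr q = \<phi> r powr p * (B powr q * N powr q)"
        using q r assms(19)[OF r] by (simp add: powr_mult powr_powr)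
      then have "r powr d * (\<psi> r * (B * N)) powr q / 2 = 2 powr q * W powr q * est.power_const * r powr d * (\<phi> r powr p * N powr q)"
        by (simp add: Bq est.power_const_def A_def)
      then show ?thesis using est.ball_integral_bessel_riesz_power_le[OF r, of x] by (simp only:)
    qed
    have loc_g: "dunkl_locally_integrable \<alpha> q ?g"
      unfolding dunkl_locally_integrable_def
    proof (intro conjI allI impI est.bessel_riesz_measurable)
      fix Y :: "real set"
      assume Y: "compact Y"
      then have [measurable]: "Y \<in> sets borel" by (rule borel_compact)
      obtain R where R: "0 < R" "\<And>z. z \<in> Y \<Longrightarrow> \<bar>z\<bar> < R"
        using bounded_pos_less[of Y] compact_imp_bounded[OF Y] by auto
      have "(\<integral>\<^sup>+z. ennreal (norm (indicator Y z *\<^sub>R norm (?g z) powr q)) \<partial>\<mu>) \<le>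
          ball_integral R (\<lambda>z. ennreal (norm (?g z) powr q)) 0"
        unfolding ball_integral_def ball_weight_zero using R(2)
        by (intro nn_integral_mono) (fastforce simp: indicator_def abs_less_iff)
      also have "\<dots> < \<infinity>" using bound[OF R(1), of 0] by (auto intro: le_less_trans)
      finally show "set_integrable \<mu> Y (\<lambda>z. norm (?g z) powr q)"
        unfolding set_integrable_def by (intro integrableI_bounded) auto
    qed
    have norm: "dunkl_morrey_norm \<alpha> q \<psi> ?g \<le> ennreal (B * N)"
      by (rule morrey_norm_leI[OF loc_g _ \<psi>_pos _ bound]) (use q B N(1) in auto)
    have "ennreal (B * N) = ennreal (B / \<kappa>) * ennreal \<kappa> * ennreal N"
      using B \<kappa>(1) N(1) by (simp add: ennreal_mult[symmetric])
    also have "\<dots> \<le> ennreal (B / \<kappa>) * dunkl_Lnorm \<alpha> t (bessel_riesz_kernel \<alpha> \<beta> \<gamma>) * ennreal N"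
      using \<kappa>(2) by (intro mult_left_mono mult_right_mono) auto
    finally have "dunkl_morrey_norm \<alpha> q \<psi> ?g \<le>
        ennreal (B / \<kappa>) * dunkl_Lnorm \<alpha> t (bessel_riesz_kernel \<alpha> \<beta> \<gamma>) * dunkl_morrey_norm \<alpha> p \<phi> f"
      unfolding N(2) by (rule order.trans[OF norm])
    moreover have "?g \<in> dunkl_morrey \<alpha> q \<psi>"
      using loc_g le_less_trans[OF norm] by (simp add: dunkl_morrey_def)
    ultimately show ?thesis using est.AE_integrable_integrand by blast
  qed
  show ?thesis
    using main B \<kappa>(1) by (intro exI[of _ "B / \<kappa>"]) auto
qed

end
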